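(* For each $n$ let $G=G_n$ be a connected simple undirected graph with vertex set $\{1,\dots,n\}$, and suppose that the graphs satisfy the geometry assumption with parameter $r\ge1$. Suppose moreover that the Laplacian eigenfunctions $\psi_0,\dots,\psi_{n-1}$, normalised to be orthonormal with respect to $\langle\cdot,\cdot\rangle_n$, are uniformly bounded by a common constant: there is $C>0$, independent of $n$, such that $|\psi_j(i)|\le C$ for all $i$ and $j$. Let $\Psi:\mathbb{R}\to(0,1)$ be a differentiable link function such that $\Psi'/(\Psi(1-\Psi))$ is uniformly bounded and $\Psi'>0$ everywhere, with inverse $\Psi^{-1}$. For $\rho:\{1,\dots,n\}\to(0,1)$ let $\mathbb{E}_\rho$ denote expectation under the model in which $Y_1,\dots,Y_n$ are independent $\{0,1\}$-valued random variables with $\mathbb{P}_\rho(Y_i=1)=\rho(i)$. Then for all $\beta\ge r/2$ and $Q>0$, $$\inf_{\hat\rho}\ \sup_{\rho:\ \Psi^{-1}(\rho)\in H^\beta(Q)}\mathbb{E}_\rho\|\hat\rho-\rho\|_n^2\asymp n^{-2\beta/(2\beta+r)}\qquad(n\to\infty),$$ where the infimum is over all estimators $\hat\rho=\hat\rho(Y_1,\dots,Y_n)$.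
   Context: Notation. For sequences of positive numbers, $a_n\asymp b_n$ means $0<\liminf a_n/b_n\le\limsup a_n/b_n<\infty$. A function on the graph is a function $f:\{1,\dots,n\}\to\mathbb{R}$. The inner product is $\langle f,g\rangle_n=\frac1n\sum_{i=1}^n f(i)g(i)$ with norm $\|f\|_n^2=\langle f,f\rangle_n$. $\Psi$ and $\Psi^{-1}$ are applied to functions on the graph pointwise; the condition $\Psi^{-1}(\rho)\in H^\beta(Q)$ means $\rho=\Psi(f)$ for some $f\in H^\beta(Q)$. Graph Laplacian. $L=D-A$, where $A$ is the adjacency matrix and $D$ the diagonal matrix of vertex degrees. Its eigenvalues (which depend on $n$), counted with multiplicity, are ordered as $0=\lambda_0<\lambda_1\le\lambda_2\le\dots\le\lambda_{n-1}$, and $\psi_0,\dots,\psi_{n-1}$ is a fixed corresponding sequence of eigenfunctions, orthonormal with respect to $\langle\cdot,\cdot\rangle_n$. Geometry assumption with parameter $r\ge1$ (for the sequence of graphs $G_n$): there exist $i_0\in\mathbb{N}$, $\kappa\in(0,1]$ and $C_1,C_2>0$ (all independent of $n$) such that for all $n$ large enough, $C_1(i/n)^{2/r}\le\lambda_i\le C_2(i/n)^{2/r}$ for all integers $i$ with $i_0\le i\le\kappa n$ (and $i\le n-1$). The parameter $r$ is real, not necessarily an integer. Sobolev-type ball. For $\beta,Q>0$ (independent of $n$), $H^\beta(Q)=\{f:\{1,\dots,n\}\to\mathbb{R}:\ \langle f,(I+(n^{2/r}L)^\beta)f\rangle_n\le Q^2\}$, where the power of the nonnegative definite matrix $n^{2/r}L$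 is defined through its spectral decomposition (with $0^\beta=0$). *)

theory Defs
  imports "HOL-Probability.Probability" "Graph_Theory.Graph_Theory"
begin

text \<open>
  A simple undirected graph is a \<^locale>\<open>pair_graph\<close>: a finite symmetric loop-free digraph whose
  arcs are pairs of vertices, so an edge \<open>{i, j}\<close> is the pair of arcs \<open>(i, j)\<close> and \<open>(j, i)\<close>.
  The qualified name of \<^const>\<open>Digraph_Component.connected\<close> avoids the topological notion.
\<close>

definition simple_connected_graph_on :: "'a set \<Rightarrow> 'a pair_pre_digraph \<Rightarrow> bool" where
  "simple_connected_graph_on V G \<longleftrightarrow>
     pair_graph G \<and> pverts G = V \<and> Digraph_Component.connected (with_proj G)"

definition adjacency :: "'a pair_pre_digraph \<Rightarrow> 'a \<Rightarrow> 'a \<Rightarrow> real" where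
  "adjacency G i j = (if (i, j) \<in> parcs G then 1 else 0)"

definition degree_matrix :: "'a pair_pre_digraph \<Rightarrow> 'a \<Rightarrow> 'a \<Rightarrow> real" where
  "degree_matrix G i j = (if i = j then real (out_degree (with_proj G) i) else 0)"

definition laplacian :: "'a pair_pre_digraph \<Rightarrow> 'a \<Rightarrow> 'a \<Rightarrow> real" where
  "laplacian G i j = degree_matrix G i j - adjacency G i j"

definition inner_n :: "nat \<Rightarrow> (nat \<Rightarrow> real) \<Rightarrow> (nat \<Rightarrow> real) \<Rightarrow> real" where
  "inner_n n f g = (1 / real n) * (\<Sum>i=1..n. f i * g i)"

definition norm_n :: "nat \<Rightarrow> (nat \<Rightarrow> real) \<Rightarrow> real" where
  "norm_n n f = sqrt (inner_n n f f)"

text \<open>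
  \<open>lam 0 \<le> \<dots> \<le> lam (n - 1)\<close> are the Laplacian eigenvalues counted with multiplicity: the \<open>n\<close>
  orthonormal eigenfunctions form a basis of the functions on \<open>{1..n}\<close>.
  For a connected graph, \<open>lam 0 = 0\<close> and \<open>lam 1 > 0\<close> are consequences and are not assumed.
\<close>

definition laplacian_eigensystem ::
    "nat \<Rightarrow> nat pair_pre_digraph \<Rightarrow> (nat \<Rightarrow> real) \<Rightarrow> (nat \<Rightarrow> nat \<Rightarrow> real) \<Rightarrow> bool" where
  "laplacian_eigensystem n G lam psi \<longleftrightarrow>
     (\<forall>j<n. \<forall>k<n. inner_n n (psi j) (psi k) = (if j = k then 1 else 0)) \<and>
     (\<forall>j<n. \<forall>i\<in>{1..n}. (\<Sum>k=1..n. laplacian G i k * psi j k) = lam j * psi j i) \<and>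
     (\<forall>j k. j \<le> k \<and> k < n \<longrightarrow> lam j \<le> lam k)"

definition geometry_assumption :: "real \<Rightarrow> (nat \<Rightarrow> nat \<Rightarrow> real) \<Rightarrow> bool" where
  "geometry_assumption r lam \<longleftrightarrow>
     (\<exists>(i0::nat) (\<kappa>::real) (C1::real) (C2::real). 0 < \<kappa> \<and> \<kappa> \<le> 1 \<and> 0 < C1 \<and> 0 < C2 \<and>
        (\<forall>\<^sub>F n in sequentially. \<forall>i. i0 \<le> i \<and> real i \<le> \<kappa> * real n \<and> i < n \<longrightarrow>
           C1 * (real i / real n) powr (2 / r) \<le> lam n i \<and>
           lam n i \<le> C2 * (real i / real n) powr (2 / r)))"

text \<open>
  \<open>spectral_power n mu psi b\<close> is \<open>M\<^sup>b\<close> for the nonnegative definite operator \<open>M\<close> with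
  eigenvalues \<open>mu j\<close> and orthonormal eigenbasis \<open>psi j\<close>. The convention \<open>0\<^sup>b = 0\<close> is
  built into \<^const>\<open>powr\<close>.
\<close>

definition spectral_power ::
    "nat \<Rightarrow> (nat \<Rightarrow> real) \<Rightarrow> (nat \<Rightarrow> nat \<Rightarrow> real) \<Rightarrow> real \<Rightarrow> (nat \<Rightarrow> real) \<Rightarrow> nat \<Rightarrow> real" where
  "spectral_power n mu psi b f i = (\<Sum>j<n. mu j powr b * inner_n n f (psi j) * psi j i)"

definition sobolev_ball ::
    "real \<Rightarrow> nat \<Rightarrow> (nat \<Rightarrow> real) \<Rightarrow> (nat \<Rightarrow> nat \<Rightarrow> real) \<Rightarrow> real \<Rightarrow> real \<Rightarrow> (nat \<Rightarrow> real) set" where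
  "sobolev_ball r n lam psi \<beta> Q =
     {f \<in> {1..n} \<rightarrow>\<^sub>E UNIV.
        inner_n n f (\<lambda>i. f i + spectral_power n (\<lambda>j. real n powr (2 / r) * lam j) psi \<beta> f i) \<le> Q\<^sup>2}"

text \<open>
  The functions \<open>\<rho>\<close> with \<open>\<Psi>\<^sup>-\<^sup>1(\<rho>) \<in> F\<close>. No surjectivity of \<open>\<Psi>\<close> onto \<open>(0, 1)\<close> is presupposed.
\<close>

definition link_class :: "nat \<Rightarrow> (real \<Rightarrow> real) \<Rightarrow> (nat \<Rightarrow> real) set \<Rightarrow> (nat \<Rightarrow> real) set" where
  "link_class n \<Psi> F = {\<rho> \<in> {1..n} \<rightarrow>\<^sub>E {0<..<1}. \<exists>f\<in>F. \<forall>i\<in>{1..n}. \<rho> i = \<Psi> (f i)}"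

text \<open>
  The labels are coded as booleans, \<open>True\<close> standing for \<open>1\<close>; a label vector is \<open>False\<close> outside
  \<open>{1..n}\<close>, so a function of it depends on \<open>Y\<^sub>1, \<dots>, Y\<^sub>n\<close> only.
\<close>

definition label_model :: "nat \<Rightarrow> (nat \<Rightarrow> real) \<Rightarrow> (nat \<Rightarrow> bool) pmf" where
  "label_model n \<rho> = Pi_pmf {1..n} False (\<lambda>i. bernoulli_pmf (\<rho> i))"

definition risk :: "nat \<Rightarrow> ((nat \<Rightarrow> bool) \<Rightarrow> nat \<Rightarrow> real) \<Rightarrow> (nat \<Rightarrow> real) \<Rightarrow> real" where
  "risk n est \<rho> =
     measure_pmf.expectation (label_model n \<rho>) (\<lambda>Y. (norm_n n (\<lambda>i. est Y i - \<rho> i))\<^sup>2)"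

definition minimax_risk :: "nat \<Rightarrow> (nat \<Rightarrow> real) set \<Rightarrow> ereal" where
  "minimax_risk n R = (INF est. SUP \<rho>\<in>R. ereal (risk n est \<rho>))"

definition same_order :: "(nat \<Rightarrow> ereal) \<Rightarrow> (nat \<Rightarrow> ereal) \<Rightarrow> bool"  (infix \<open>\<asymp>\<close> 50) where
  "a \<asymp> b \<longleftrightarrow> 0 < liminf (\<lambda>n. a n / b n) \<and> limsup (\<lambda>n. a n / b n) < \<infinity>"

end

theory Submission
  imports Defs
begin

text \<open>
  Write \<open>\<alpha> = \<beta> / r\<close> and \<open>N = \<lceil>n powr (1 / (2 * \<alpha> + 1))\<rceil>\<close>. In the coordinates
  given by the eigenbasis the ball is, up to constants, the ellipsoid \<open>\<Sum>j. j powr (2 * \<alpha>) * (f j)\<^sup>2 \<le> Q\<^sup>2\<close>.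

  Upper bound: least squares over the functions \<open>\<Psi> \<circ> g\<close>, where the first \<open>N\<close> coordinates of \<open>g\<close>
  are integer multiples of \<open>1 / sqrt n\<close> lying in the ellipsoid and the others vanish. Truncation and
  rounding cost \<open>N powr (- 2 * \<alpha>) + N / n\<close>, and comparison with a Gaussian sum shows that there are
  only \<open>exp (K * N)\<close> such \<open>g\<close>, so that no logarithmic factor is lost. No smoothness of \<open>\<Psi> \<circ> f\<close>
  is needed, only that \<open>\<Psi>\<close> is Lipschitz.

  Lower bound: Assouad's lemma for the functions \<open>\<Psi> \<circ> (x0 + \<delta> * (\<Sum>j\<in>T. psi j))\<close> with
  \<open>T \<subseteq> {N..<2 * N}\<close> and \<open>\<delta>\<close> a small multiple of \<open>1 / sqrt n\<close>. Since \<open>\<beta> \<ge> r / 2\<close> and the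
  eigenfunctions are bounded, the perturbations are uniformly small. As \<open>\<Psi>'\<close> need not be
  bounded away from \<open>0\<close> near the origin, Baire's theorem is used to choose the centre \<open>x0\<close>.
\<close>

section \<open>The link function\<close>

text \<open>Since \<open>\<Psi> x * (1 - \<Psi> x)\<close> lies in \<open>(0, 1]\<close>, the bound
  on the quotient bounds \<open>\<Psi>'\<close> itself, and the mean value inequality
  applies.\<close>

lemma link_lipschitz:
  fixes \<Psi> \<Psi>' :: "real \<Rightarrow> real"
  assumes range: "\<And>x. \<Psi> x \<in> {0<..<1}"
    and deriv: "\<And>x. (\<Psi> has_real_derivative \<Psi>' x) (at x)"
    and bdd: "bounded (range (\<lambda>x. \<Psi>' x / (\<Psi> x * (1 - \<Psi> x))))"
  obtains L where "L > 0" "\<And>x y. \<bar>\<Psi> x - \<Psi> y\<bar> \<le> L * \<bar>x - y\<bar>"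
proof -
  obtain B where B: "B > 0" "\<And>x. \<bar>\<Psi>' x / (\<Psi> x * (1 - \<Psi> x))\<bar> \<le> B"
    using bdd by (auto simp: bounded_pos)
  have bound: "\<bar>\<Psi>' x\<bar> \<le> B" for x
  proof -
    have 1: "0 < \<Psi> x * (1 - \<Psi> x)" "\<Psi> x * (1 - \<Psi> x) \<le> 1"
      using range[of x] by (auto intro: mult_le_one)
    have "\<bar>\<Psi>' x\<bar> = \<bar>\<Psi>' x / (\<Psi> x * (1 - \<Psi> x))\<bar> * (\<Psi> x * (1 - \<Psi> x))"
      using 1(1) by (metis abs_mult abs_of_pos nonzero_eq_divide_eq less_irrefl)
    also have "\<dots> \<le> B * 1" using 1 B(1) by (intro mult_mono B(2)) auto
    finally show ?thesis by simp
  qed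
  have "norm (\<Psi> x - \<Psi> y) \<le> B * norm (x - y)" for x y
    by (rule field_differentiable_bound[where S = UNIV and f' = \<Psi>'])
       (use deriv bound in auto)
  with B(1) show ?thesis by (intro that[of B]) auto
qed

text \<open>\<open>g'\<close> is not assumed continuous, so its positivity at a point gives no
  uniform lower bound nearby. Baire's theorem supplies an interval, centred within \<open>q\<close>
  of the origin, on which one constant serves all pairs of points.\<close>

lemma pos_derivative_lower_lipschitz:
  fixes g g' :: "real \<Rightarrow> real"
  assumes deriv: "\<And>x. (g has_real_derivative g' x) (at x)"
    and pos: "\<And>x. g' x > 0"
    and "q > 0"
  obtains x0 \<eta> c where "\<bar>x0\<bar> \<le> q" "\<eta> > 0" "c > 0"
    "\<And>x y. \<bar>x - x0\<bar> \<le> \<eta> \<Longrightarrow> \<bar>y - x0\<bar> \<le> \<eta> \<Longrightarrow> c * \<bar>x - y\<bar> \<le> \<bar>g x - g y\<bar>"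
proof -
  define e where "e k = 1 / real (Suc k)" for k
  \<comment> \<open>\<open>E k\<close> collects the \<open>x\<close> whose difference quotients have
    modulus at least \<open>e k\<close> for all \<open>y\<close> closer than \<open>e k\<close>.
    Writing the implication as a union of two closed conditions makes closedness immediate.\<close>
  define E where "E k = (\<Inter>y. {x. e k \<le> \<bar>y - x\<bar>} \<union> {x. e k * \<bar>y - x\<bar> \<le> \<bar>g y - g x\<bar>})" for k
  have cont: "continuous_on UNIV g"
    using deriv by (meson DERIV_isCont continuous_at_imp_continuous_on)
  have E_closed: "closed (E k)" for k
    unfolding E_def
    by (intro closed_INT ballI closed_Un closed_Collect_le continuous_intros cont)
  have E_cover: "\<exists>k. x \<in> E k" for x
  proof -
    have "(g has_derivative (\<lambda>h. g' x * h)) (at x)"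
      using deriv[of x] by (simp add: has_field_derivative_def)
    then obtain d where d: "d > 0"
      "\<And>y. \<bar>y - x\<bar> < d \<Longrightarrow> \<bar>g y - g x - g' x * (y - x)\<bar> \<le> g' x / 2 * \<bar>y - x\<bar>"
      unfolding has_derivative_at_alt real_norm_def
      using pos[of x] by (meson half_gt_zero)
    obtain k where k: "e k < min d (g' x / 2)"
      using d(1) pos[of x] nat_approx_posE[of "min d (g' x / 2)"] by (auto simp: e_def)
    have "e k * \<bar>y - x\<bar> \<le> \<bar>g y - g x\<bar>" if "\<bar>y - x\<bar> < e k" for y
    proof -
      have "\<bar>g' x * (y - x)\<bar> = g' x * \<bar>y - x\<bar>" using pos[of x] by (simp add: abs_mult)
      moreover have "\<bar>g y - g x - g' x * (y - x)\<bar> \<le> g' x / 2 * \<bar>y - x\<bar>" using d(2) that k by simp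
      moreover have "\<bar>g' x * (y - x)\<bar> \<le> \<bar>g y - g x - g' x * (y - x)\<bar> + \<bar>g y - g x\<bar>" by linarith
      ultimately have "g' x / 2 * \<bar>y - x\<bar> \<le> \<bar>g y - g x\<bar>" by (simp add: field_simps)
      moreover have "e k * \<bar>y - x\<bar> \<le> g' x / 2 * \<bar>y - x\<bar>" using k by (intro mult_right_mono) auto
      ultimately show ?thesis by simp
    qed
    then show ?thesis by (intro exI[of _ k]) (simp add: E_def, meson not_le)
  qed
  \<comment> \<open>Adding the points beyond \<open>q\<close> forces a ball that misses
    \<open>W k\<close> to lie in \<open>[-q, q]\<close> as well as in \<open>E k\<close>. If every
    \<open>W k\<close> were dense, so would be their intersection; but the sets \<open>E k\<close>
    cover the line, which keeps that intersection away from \<open>0\<close>.\<close>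
  define W where "W k = - E k \<union> {x. q < \<bar>x\<bar>}" for k
  have W_open: "open (W k)" for k
    unfolding W_def by (intro open_Un open_Compl E_closed open_Collect_less continuous_intros)
  have "\<exists>k. closure (W k) \<noteq> UNIV"
  proof (rule ccontr)
    assume "\<not> ?thesis"
    then have "UNIV \<subseteq> closure (\<Inter>(range W))"
      using W_open by (intro Baire) auto
    moreover have "\<Inter>(range W) \<subseteq> {x. q \<le> \<bar>x\<bar>}" using E_cover by (force simp: W_def)
    moreover have "closed {x::real. q \<le> \<bar>x\<bar>}" by (intro closed_Collect_le continuous_intros)
    ultimately have "0 \<in> {x::real. q \<le> \<bar>x\<bar>}" using closure_minimal by blast
    with \<open>q > 0\<close> show False by simp
  qed
  then obtain k x0 where "x0 \<in> - closure (W k)" by auto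
  then obtain \<epsilon> where \<epsilon>: "\<epsilon> > 0" "ball x0 \<epsilon> \<subseteq> - closure (W k)"
    using open_contains_ball[of "- closure (W k)"] by auto
  have sub: "x \<in> E k \<and> \<bar>x\<bar> \<le> q" if "\<bar>x - x0\<bar> < \<epsilon>" for x
  proof -
    have "x \<notin> W k" using that \<epsilon> closure_subset[of "W k"] by (force simp: dist_real_def)
    then show ?thesis by (auto simp: W_def)
  qed
  \<comment> \<open>This radius puts both points inside the ball and makes their distance at most
    \<open>2 / 3 * e k\<close>, within reach of the defining property of \<open>E k\<close>.\<close>
  define \<eta> where "\<eta> = min (\<epsilon> / 2) (e k / 3)"
  have e_pos: "e k > 0" by (simp add: e_def)
  have "e k * \<bar>x - y\<bar> \<le> \<bar>g x - g y\<bar>" if "\<bar>x - x0\<bar> \<le> \<eta>" "\<bar>y - x0\<bar> \<le> \<eta>" for x y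
  proof -
    have \<eta>: "\<eta> \<le> \<epsilon> / 2" "\<eta> \<le> e k / 3" by (auto simp: \<eta>_def)
    have "y \<in> E k" using sub[of y] that \<eta> \<epsilon> by linarith
    moreover have "\<bar>x - y\<bar> < e k" using that \<eta> e_pos by linarith
    ultimately show ?thesis by (force simp: E_def)
  qed
  moreover have "\<bar>x0\<bar> \<le> q" using sub[of x0] \<epsilon> by simp
  moreover have "\<eta> > 0" using \<epsilon> e_pos by (simp add: \<eta>_def)
  ultimately show ?thesis using that e_pos by blast
qed

section \<open>Laplacian eigenbases\<close>

lemma inner_n_commute: "inner_n n f g = inner_n n g f"
  by (simp add: inner_n_def mult.commute)

lemma norm_n_sq: "(norm_n n f)\<^sup>2 = inner_n n f f"
  by (simp add: norm_n_def inner_n_def sum_nonneg)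

lemma norm_n_sq_eq: "(norm_n n f)\<^sup>2 = (1 / real n) * (\<Sum>i=1..n. (f i)\<^sup>2)"
  unfolding norm_n_sq inner_n_def by (simp add: power2_eq_square)

lemma norm_n_sq_scale: "(norm_n n (\<lambda>i. c * f i))\<^sup>2 = c\<^sup>2 * (norm_n n f)\<^sup>2"
  by (simp add: norm_n_sq_eq power_mult_distrib flip: sum_distrib_left)

lemma norm_n_sq_mono:
  assumes "\<And>i. i \<in> {1..n} \<Longrightarrow> (f i)\<^sup>2 \<le> (g i)\<^sup>2"
  shows "(norm_n n f)\<^sup>2 \<le> (norm_n n g)\<^sup>2"
  unfolding norm_n_sq_eq using assms by (intro mult_left_mono sum_mono) auto

lemma norm_n_sq_diff_le:
  "(norm_n n (\<lambda>i. f i - h i))\<^sup>2 \<le>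
     2 * (norm_n n (\<lambda>i. f i - g i))\<^sup>2 + 2 * (norm_n n (\<lambda>i. g i - h i))\<^sup>2"
proof -
  have "(f i - h i)\<^sup>2 \<le> 2 * (f i - g i)\<^sup>2 + 2 * (g i - h i)\<^sup>2" for i
    using zero_le_power2[of "(f i - g i) - (g i - h i)"] by (simp add: power2_eq_square algebra_simps)
  then have "(\<Sum>i=1..n. (f i - h i)\<^sup>2) \<le> 2 * (\<Sum>i=1..n. (f i - g i)\<^sup>2) + 2 * (\<Sum>i=1..n. (g i - h i)\<^sup>2)"
    by (simp add: sum_distrib_left flip: sum.distrib) (intro sum_mono, simp)
  then show ?thesis by (simp add: norm_n_sq_eq divide_right_mono flip: add_divide_distrib)
qed

lemma inner_n_lincomb:
  "inner_n n f (\<lambda>i. \<Sum>j\<in>A. a j * p j i) = (\<Sum>j\<in>A. a j * inner_n n f (p j))"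
  unfolding inner_n_def sum_distrib_left sum_distrib_right
  by (subst sum.swap) (simp add: mult_ac)

lemma inner_n_cong:
  assumes "\<And>i. i \<in> {1..n} \<Longrightarrow> f i = f' i" "\<And>i. i \<in> {1..n} \<Longrightarrow> g i = g' i"
  shows "inner_n n f g = inner_n n f' g'"
  using assms by (simp add: inner_n_def)

text \<open>The adjacency entries of column \<open>k\<close> count the arcs into \<open>k\<close>;
  by symmetry of the arcs this is the number of arcs out of \<open>k\<close>, the diagonal entry of
  the degree matrix.\<close>

lemma laplacian_column_sum:
  fixes n k :: nat
  assumes "simple_connected_graph_on {1..n} G" "k \<in> {1..n}"
  shows "(\<Sum>i=1..n. laplacian G i k) = 0"
proof -
  interpret pair_graph G using assms by (simp add: simple_connected_graph_on_def)
  have verts: "pverts G = {1..n}" using assms by (simp add: simple_connected_graph_on_def)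
  let ?I = "{i \<in> {1..n}. (i, k) \<in> parcs G}"
  have "?I = snd ` out_arcs (with_proj G) k"
  proof (rule set_eqI, rule iffI)
    fix i assume "i \<in> ?I"
    then have "(k, i) \<in> out_arcs (with_proj G) k" using arcs_symmetric by (simp add: out_arcs_def)
    then show "i \<in> snd ` out_arcs (with_proj G) k" by force
  next
    fix i assume "i \<in> snd ` out_arcs (with_proj G) k"
    then have "(k, i) \<in> parcs G" by (auto simp: out_arcs_def)
    then show "i \<in> ?I" using arcs_symmetric in_arcsD2 verts by blast
  qed
  moreover have "inj_on snd (out_arcs (with_proj G) k)"
    by (rule inj_onI) (auto simp: out_arcs_def prod_eq_iff)
  ultimately have deg: "card ?I = out_degree (with_proj G) k"
    by (simp only: out_degree_def card_image)
  have "(\<Sum>i=1..n. adjacency G i k) = (\<Sum>i\<in>?I. 1)"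
    unfolding adjacency_def by (rule sum.inter_filter[symmetric]) simp
  also have "\<dots> = real (out_degree (with_proj G) k)" by (simp only: deg[symmetric] real_of_card)
  finally have adj: "(\<Sum>i=1..n. adjacency G i k) = real (out_degree (with_proj G) k)" .
  have "(\<Sum>i=1..n. degree_matrix G i k) = real (out_degree (with_proj G) k)"
    unfolding degree_matrix_def using assms(2) by (subst sum.delta) auto
  then show ?thesis using adj unfolding laplacian_def sum_subtractf by simp
qed

section \<open>Expansion and Parseval's identity for \<open>n\<close> orthonormal functions on
  \<open>n\<close> points\<close>

locale orthonormal_system =
  fixes n :: nat and psi :: "nat \<Rightarrow> nat \<Rightarrow> real"
  assumes orthonormal: "\<And>j k. j < n \<Longrightarrow> k < n \<Longrightarrow> inner_n n (psi j) (psi k) = (if j = k then 1 else 0)"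
begin

lemma inner_lincomb:
  assumes "A \<subseteq> {..<n}" "k < n"
  shows "inner_n n (\<lambda>i. \<Sum>j\<in>A. a j * psi j i) (psi k) = (if k \<in> A then a k else 0)"
proof -
  have fin: "finite A" using assms finite_subset by blast
  have "inner_n n (\<lambda>i. \<Sum>j\<in>A. a j * psi j i) (psi k) = (\<Sum>j\<in>A. a j * inner_n n (psi k) (psi j))"
    by (subst inner_n_commute) (rule inner_n_lincomb)
  also have "\<dots> = (\<Sum>j\<in>A. if k = j then a k else 0)"
    using assms orthonormal by (intro sum.cong) auto
  finally show ?thesis using fin by simp
qed

lemma norm_lincomb:
  assumes "A \<subseteq> {..<n}"
  shows "(norm_n n (\<lambda>i. \<Sum>j\<in>A. a j * psi j i))\<^sup>2 = (\<Sum>j\<in>A. (a j)\<^sup>2)"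
  unfolding norm_n_sq inner_n_lincomb
  using assms inner_lincomb[OF assms] by (intro sum.cong) (auto simp: power2_eq_square)

text \<open>
  Bessel's inequality for the \<open>n\<close> indicator functions of the points, summed over the points,
  is an equality; so it is an equality for each of them.
\<close>

lemma expansion:
  assumes "i \<in> {1..n}"
  shows "f i = (\<Sum>j<n. inner_n n f (psi j) * psi j i)"
proof -
  define D where "D k i = (if i = k then 1 else 0 :: real)" for k i :: nat
  define R where "R k i = D k i - (\<Sum>j<n. inner_n n (D k) (psi j) * psi j i)" for k i
  have n: "n > 0" using assms by auto
  have inner_D: "inner_n n (D k) g = g k / n" if "k \<in> {1..n}" for k g
    using that by (simp add: inner_n_def D_def if_distrib[of "\<lambda>x. x * _"] cong: if_cong)
  have R_norm: "(norm_n n (R k))\<^sup>2 = 1 / n - (\<Sum>j<n. (psi j k)\<^sup>2 / n\<^sup>2)" if k: "k \<in> {1..n}" for k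
  proof -
    let ?P = "\<lambda>i. \<Sum>j<n. inner_n n (D k) (psi j) * psi j i"
    have "(norm_n n (R k))\<^sup>2 = inner_n n (D k) (D k) - 2 * inner_n n (D k) ?P + (norm_n n ?P)\<^sup>2"
      unfolding norm_n_sq R_def
      by (simp add: inner_n_def algebra_simps sum.distrib sum_subtractf diff_divide_distrib
          add_divide_distrib sum_distrib_left)
    also have "inner_n n (D k) (D k) = 1 / n" using inner_D[OF k] by (simp add: D_def)
    also have "inner_n n (D k) ?P = (\<Sum>j<n. (psi j k)\<^sup>2 / n\<^sup>2)"
      unfolding inner_n_lincomb by (simp add: inner_D[OF k] power2_eq_square)
    also have "(norm_n n ?P)\<^sup>2 = (\<Sum>j<n. (psi j k)\<^sup>2 / n\<^sup>2)"
      by (subst norm_lincomb) (simp_all add: inner_D[OF k] power_divide)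
    finally show ?thesis by simp
  qed
  have "(\<Sum>k=1..n. (norm_n n (R k))\<^sup>2) = 1 - (\<Sum>k=1..n. \<Sum>j<n. (psi j k)\<^sup>2 / n\<^sup>2)"
    using n by (simp add: R_norm sum_subtractf)
  \<comment> \<open>Summing over the points first leaves \<open>n\<close> copies of
    \<open>1 / n\<close>, because every \<open>psi j\<close> has norm one; this cancels the total
    squared norm of the indicators.\<close>
  also have "(\<Sum>k=1..n. \<Sum>j<n. (psi j k)\<^sup>2 / n\<^sup>2) = (\<Sum>j<n. 1 / n * inner_n n (psi j) (psi j))"
    by (subst sum.swap) (simp add: inner_n_def power2_eq_square sum_divide_distrib)
  also have "\<dots> = 1" using n by (simp add: orthonormal)
  finally have "(\<Sum>k=1..n. (norm_n n (R k))\<^sup>2) = 0" by linarith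
  then have "\<forall>k\<in>{1..n}. (norm_n n (R k))\<^sup>2 = 0"
    by (subst (asm) sum_nonneg_eq_0_iff) auto
  then have R0: "R k i = 0" if "k \<in> {1..n}" for k
    using assms n that by (auto simp: norm_n_sq_eq sum_nonneg_eq_0_iff)
  \<comment> \<open>Every function is a linear combination of indicators, and at \<open>i\<close>
    each indicator agrees with its projection because \<open>R k i = 0\<close>.\<close>
  have "f i = (\<Sum>k=1..n. f k * D k i)" using assms by (simp add: D_def if_distrib cong: if_cong)
  also have "\<dots> = (\<Sum>k=1..n. f k * (\<Sum>j<n. psi j k / n * psi j i))"
    using R0 by (intro sum.cong) (auto simp: R_def inner_D)
  also have "\<dots> = (\<Sum>j<n. inner_n n f (psi j) * psi j i)"
    unfolding inner_n_def sum_distrib_left sum_distrib_right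
    by (subst sum.swap) (simp add: mult_ac)
  finally show ?thesis .
qed

lemma inner_sobolev:
  "inner_n n f (\<lambda>i. f i + spectral_power n mu psi b f i) =
     (norm_n n f)\<^sup>2 + (\<Sum>j<n. mu j powr b * (inner_n n f (psi j))\<^sup>2)"
proof -
  have "inner_n n f (\<lambda>i. f i + spectral_power n mu psi b f i) =
      inner_n n f f + inner_n n f (spectral_power n mu psi b f)"
    by (simp add: inner_n_def algebra_simps sum.distrib add_divide_distrib)
  also have "inner_n n f (spectral_power n mu psi b f) =
      (\<Sum>j<n. (mu j powr b * inner_n n f (psi j)) * inner_n n f (psi j))"
    unfolding spectral_power_def[abs_def] by (rule inner_n_lincomb)
  finally show ?thesis unfolding norm_n_sq by (simp add: power2_eq_square mult.assoc)
qed

lemma parseval: "(norm_n n f)\<^sup>2 = (\<Sum>j<n. (inner_n n f (psi j))\<^sup>2)"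
proof -
  have "(norm_n n f)\<^sup>2 = (norm_n n (\<lambda>i. \<Sum>j<n. inner_n n f (psi j) * psi j i))\<^sup>2"
    unfolding norm_n_sq by (intro inner_n_cong) (auto simp: expansion)
  then show ?thesis by (simp add: norm_lincomb)
qed

end

text \<open>Constants lie in the kernel of the symmetric matrix \<open>L\<close>.\<close>

lemma eigenfunction_orthogonal_const:
  assumes "simple_connected_graph_on {1..n} G" "laplacian_eigensystem n G lam psi"
    and "j < n" "lam j \<noteq> 0"
  shows "inner_n n (\<lambda>_. c) (psi j) = 0"
proof -
  have "lam j * (\<Sum>i=1..n. psi j i) = (\<Sum>i=1..n. \<Sum>k=1..n. laplacian G i k * psi j k)"
    using assms by (simp add: laplacian_eigensystem_def sum_distrib_left)
  also have "\<dots> = (\<Sum>k=1..n. (\<Sum>i=1..n. laplacian G i k) * psi j k)"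
    unfolding sum_distrib_right by (rule sum.swap)
  also have "\<dots> = 0" using laplacian_column_sum[OF assms(1)] by simp
  finally show ?thesis using assms(4) by (simp add: inner_n_def flip: sum_distrib_left)
qed

section \<open>Assouad's lemma for binary labels\<close>

text \<open>One finite set that contains the support for every \<open>\<rho>\<close>, so that
  expectations under different parameters become sums over a common index set.\<close>

definition label_space :: "nat \<Rightarrow> (nat \<Rightarrow> bool) set" where
  "label_space n = PiE_dflt {1..n} False (\<lambda>_. UNIV)"

lemma finite_label_space: "finite (label_space n)"
  unfolding label_space_def by (intro finite_PiE_dflt) auto

lemma set_label_model: "set_pmf (label_model n \<rho>) \<subseteq> label_space n"
  unfolding label_model_def label_space_def by (auto simp: set_Pi_pmf PiE_dflt_def)

lemma expectation_label_model:
  "measure_pmf.expectation (label_model n \<rho>) F =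
     (\<Sum>Y\<in>label_space n. pmf (label_model n \<rho>) Y * (F Y :: real))"
  by (subst integral_measure_pmf_real[OF finite_label_space])
     (use set_label_model in \<open>auto simp: mult.commute\<close>)

lemma sum_pmf_label_model: "(\<Sum>Y\<in>label_space n. pmf (label_model n \<rho>) Y) = 1"
  by (rule sum_pmf_eq_1[OF finite_label_space set_label_model])

lemma integrable_label_model: "integrable (label_model n \<rho>) (F :: _ \<Rightarrow> real)"
  by (rule integrable_measure_pmf_finite) (rule finite_subset[OF set_label_model finite_label_space])

text \<open>The left-hand side is the Hellinger affinity of two product measures. It factorises
  because a sum over label vectors of products of coordinate terms is the product of the coordinate
  sums.\<close>

lemma affinity_label_model:
  assumes "\<And>i. i \<in> {1..n} \<Longrightarrow> p i \<in> {0<..<1} \<and> q i \<in> {0<..<1}"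
  shows "(\<Sum>Y\<in>label_space n. sqrt (pmf (label_model n p) Y * pmf (label_model n q) Y)) =
    (\<Prod>i=1..n. sqrt (p i * q i) + sqrt ((1 - p i) * (1 - q i)))"
proof -
  let ?A = "{1..n}"
  \<comment> \<open>Extensional functions are \<open>undefined\<close> outside
    \<open>{1..n}\<close>, label vectors are \<open>False\<close> there; \<open>?ext\<close>
    translates the former into the latter.\<close>
  let ?ext = "\<lambda>h x. if x \<in> ?A then h x else False"
  have sqrt_prod: "sqrt (prod f A) = (\<Prod>i\<in>A. sqrt (f i))" for f :: "nat \<Rightarrow> real" and A
    by (induction A rule: infinite_finite_induct) (auto simp: real_sqrt_mult)
  have pmf_ext: "pmf (label_model n p) (?ext h) = (\<Prod>i\<in>?A. pmf (bernoulli_pmf (p i)) (h i))" for p h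
    unfolding label_model_def by (subst pmf_Pi') auto
  have inj: "inj_on ?ext (PiE ?A (\<lambda>_. UNIV))"
  proof (rule inj_onI)
    fix g h assume *: "g \<in> PiE ?A (\<lambda>_. UNIV)" "h \<in> PiE ?A (\<lambda>_. UNIV)" "?ext g = ?ext h"
    show "g = h"
      by (rule PiE_ext[OF *(1,2)]) (use *(3) in \<open>metis (full_types)\<close>)
  qed
  have "(\<Sum>Y\<in>label_space n. sqrt (pmf (label_model n p) Y * pmf (label_model n q) Y)) =
      (\<Sum>h\<in>PiE ?A (\<lambda>_. UNIV). sqrt (pmf (label_model n p) (?ext h) * pmf (label_model n q) (?ext h)))"
    unfolding label_space_def dflt_image_PiE[symmetric]
    by (subst sum.reindex[OF inj]) simp
  also have "\<dots> = (\<Sum>h\<in>PiE ?A (\<lambda>_. UNIV).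
      \<Prod>i\<in>?A. sqrt (pmf (bernoulli_pmf (p i)) (h i) * pmf (bernoulli_pmf (q i)) (h i)))"
    by (simp only: pmf_ext sqrt_prod prod.distrib[symmetric])
  also have "\<dots> = (\<Prod>i\<in>?A. \<Sum>b\<in>UNIV. sqrt (pmf (bernoulli_pmf (p i)) b * pmf (bernoulli_pmf (q i)) b))"
    by (subst prod_sum_PiE) auto
  also have "\<dots> = (\<Prod>i\<in>?A. sqrt (p i * q i) + sqrt ((1 - p i) * (1 - q i)))"
    using assms by (intro prod.cong refl) (force simp: UNIV_bool less_imp_le)
  finally show ?thesis .
qed

text \<open>A Weierstrass product inequality, by induction: a factor \<open>f i \<le> 1\<close>
  lowers a product that is at most \<open>1\<close> by at most \<open>1 - f i\<close>.\<close>

lemma prod_ge_one_minus_sum: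
  fixes f x :: "'a \<Rightarrow> real"
  assumes "\<And>i. i \<in> A \<Longrightarrow> 0 \<le> f i \<and> f i \<le> 1 \<and> 1 - x i \<le> f i"
  shows "1 - sum x A \<le> prod f A"
  using assms
proof (induction A rule: infinite_finite_induct)
  case (insert i A)
  have "prod f A \<le> 1" "0 \<le> prod f A" using insert.prems by (auto intro: prod_le_1 prod_nonneg)
  moreover have "1 - x i \<le> f i" "f i \<le> 1" "1 - sum x A \<le> prod f A" using insert by auto
  moreover have "(1 - f i) * prod f A \<le> 1 - f i"
    using calculation by (intro mult_left_le) auto
  ultimately show ?case using insert.hyps by (simp add: algebra_simps)
qed auto

text \<open>The gap between arithmetic and geometric mean is
  \<open>(sqrt p - sqrt q)\<^sup>2 / 2\<close>, and this square is \<open>(p - q)\<^sup>2\<close>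
  divided by \<open>(sqrt p + sqrt q)\<^sup>2\<close>, which is at least
  \<open>4 * a\<close>.\<close>

lemma sqrt_mult_ge:
  fixes a p q :: real
  assumes "0 < a" "a \<le> p" "a \<le> q"
  shows "(p + q) / 2 - (p - q)\<^sup>2 / (8 * a) \<le> sqrt (p * q)"
proof -
  define u v where "u = sqrt p" and "v = sqrt q"
  have u: "u\<^sup>2 = p" "u > 0" "v\<^sup>2 = q" "v > 0" using assms by (auto simp: u_def v_def)
  have "sqrt a \<le> u" "sqrt a \<le> v" using assms by (auto simp: u_def v_def)
  then have "(2 * sqrt a)\<^sup>2 \<le> (u + v)\<^sup>2" using assms by (intro power_mono) auto
  then have "4 * a \<le> (u + v)\<^sup>2" using assms by (simp add: power_mult_distrib)
  then have "4 * a * (u - v)\<^sup>2 \<le> (u + v)\<^sup>2 * (u - v)\<^sup>2" by (intro mult_right_mono) auto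
  also have "(u + v)\<^sup>2 * (u - v)\<^sup>2 = (p - q)\<^sup>2"
    unfolding u(1,3)[symmetric] by (simp add: power2_eq_square algebra_simps)
  finally have "(u - v)\<^sup>2 / 2 \<le> (p - q)\<^sup>2 / (8 * a)" using assms by (simp add: field_simps)
  moreover have "sqrt (p * q) = (p + q) / 2 - (u - v)\<^sup>2 / 2"
    unfolding u(1,3)[symmetric] using u(2,4)
    by (simp add: real_sqrt_mult power2_eq_square field_simps)
  ultimately show ?thesis by linarith
qed

text \<open>The arithmetic-geometric inequality for four times the smaller and a quarter of the
  larger number. With these weights the last term sums to only \<open>1 / 4\<close> over two
  probability vectors.\<close>

lemma sqrt_mult_le_min:
  fixes P Q :: real
  assumes "0 \<le> P" "0 \<le> Q"
  shows "sqrt (P * Q) \<le> 2 * min P Q + (P + Q) / 8"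
proof -
  have *: "sqrt (x * y) \<le> 2 * x + (x + y) / 8" if "0 \<le> x" "0 \<le> y" for x y :: real
  proof -
    have "sqrt (4 * x * (y / 4)) \<le> (4 * x + y / 4) / 2"
      using that by (intro arith_geo_mean_sqrt) auto
    moreover have "4 * x * (y / 4) = x * y" by simp
    ultimately have "sqrt (x * y) \<le> (4 * x + y / 4) / 2" by metis
    also have "\<dots> \<le> 2 * x + (x + y) / 8" using that by simp
    finally show ?thesis .
  qed
  show ?thesis using *[of P Q] *[of Q P] assms by (cases "P \<le> Q") (auto simp: min_def mult.commute add.commute)
qed

text \<open>Each coordinate of the affinity loses at most
  \<open>(p i - q i)\<^sup>2 / (4 * a)\<close>, so closeness keeps the affinity at least
  \<open>1 / 2\<close>. Twice the overlap plus \<open>1 / 4\<close> dominates the affinity, whence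
  \<open>1 / 8\<close>.\<close>

lemma overlap_label_model:
  assumes "a > 0"
    and "\<And>i. i \<in> {1..n} \<Longrightarrow> p i \<in> {a..1 - a} \<and> q i \<in> {a..1 - a}"
    and "real n * (norm_n n (\<lambda>i. p i - q i))\<^sup>2 \<le> 2 * a"
  shows "1 / 8 \<le> (\<Sum>Y\<in>label_space n. min (pmf (label_model n p) Y) (pmf (label_model n q) Y))"
proof -
  let ?P = "pmf (label_model n p)" and ?Q = "pmf (label_model n q)"
  have pq: "p i \<in> {0<..<1} \<and> q i \<in> {0<..<1}" if "i \<in> {1..n}" for i
    using assms(1) assms(2)[OF that] by auto
  have "1 - (\<Sum>i=1..n. (p i - q i)\<^sup>2 / (4 * a)) \<le>
      (\<Prod>i=1..n. sqrt (p i * q i) + sqrt ((1 - p i) * (1 - q i)))"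
  proof (intro prod_ge_one_minus_sum conjI)
    fix i assume i: "i \<in> {1..n}"
    show "0 \<le> sqrt (p i * q i) + sqrt ((1 - p i) * (1 - q i))"
      using pq[OF i] by simp
    have "sqrt (p i * q i) \<le> (p i + q i) / 2"
      "sqrt ((1 - p i) * (1 - q i)) \<le> ((1 - p i) + (1 - q i)) / 2"
      using pq[OF i] by (intro arith_geo_mean_sqrt; simp)+
    then show "sqrt (p i * q i) + sqrt ((1 - p i) * (1 - q i)) \<le> 1" by simp
    have "(p i + q i) / 2 - (p i - q i)\<^sup>2 / (8 * a) \<le> sqrt (p i * q i)"
      "((1 - p i) + (1 - q i)) / 2 - ((1 - p i) - (1 - q i))\<^sup>2 / (8 * a) \<le> sqrt ((1 - p i) * (1 - q i))"
      using assms(1) assms(2)[OF i] by (intro sqrt_mult_ge; simp)+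
    then show "1 - (p i - q i)\<^sup>2 / (4 * a) \<le> sqrt (p i * q i) + sqrt ((1 - p i) * (1 - q i))"
      by (simp add: power2_commute[of "q i"] field_simps)
  qed
  also have "\<dots> = (\<Sum>Y\<in>label_space n. sqrt (?P Y * ?Q Y))"
    using affinity_label_model[OF pq] by simp
  also have "\<dots> \<le> (\<Sum>Y\<in>label_space n. 2 * min (?P Y) (?Q Y) + (?P Y + ?Q Y) / 8)"
    by (intro sum_mono sqrt_mult_le_min) auto
  also have "\<dots> = 2 * (\<Sum>Y\<in>label_space n. min (?P Y) (?Q Y)) + 1 / 4"
    by (simp add: sum.distrib sum_pmf_label_model flip: sum_distrib_left sum_divide_distrib)
  finally have "3 / 4 - (\<Sum>i=1..n. (p i - q i)\<^sup>2 / (4 * a)) \<le>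
      2 * (\<Sum>Y\<in>label_space n. min (?P Y) (?Q Y))" by simp
  moreover have "(\<Sum>i=1..n. (p i - q i)\<^sup>2) \<le> 2 * a"
    using assms(3) by (cases "n = 0") (auto simp: norm_n_sq_eq)
  then have "(\<Sum>i=1..n. (p i - q i)\<^sup>2 / (4 * a)) \<le> 1 / 2"
    using assms(1) by (simp add: field_simps flip: sum_divide_distrib)
  ultimately show ?thesis by simp
qed

section \<open>Averaging over the vertices of a hypercube\<close>

definition hamming :: "'a set \<Rightarrow> 'a set \<Rightarrow> 'a set \<Rightarrow> nat" where
  "hamming J S T = card {j \<in> J. (j \<in> S) \<noteq> (j \<in> T)}"

text \<open>Pairs each vertex of the hypercube with its neighbour in direction
  \<open>j\<close>.\<close>

lemma sum_Pow_split:
  assumes "finite J" "j \<in> J"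
  shows "(\<Sum>T\<in>Pow J. h T) = (\<Sum>T\<in>Pow (J - {j}). h T + h (insert j T) :: real)"
proof -
  have "Pow J = Pow (J - {j}) \<union> insert j ` Pow (J - {j})"
    using Pow_insert[of j "J - {j}"] assms(2) by (simp add: insert_absorb)
  then have "(\<Sum>T\<in>Pow J. h T) = (\<Sum>T\<in>Pow (J - {j}). h T) + (\<Sum>T\<in>insert j ` Pow (J - {j}). h T)"
    using assms(1) by (simp only:) (subst sum.union_disjoint, auto)
  also have "(\<Sum>T\<in>insert j ` Pow (J - {j}). h T) = (\<Sum>T\<in>Pow (J - {j}). h (insert j T))"
  proof -
    have "inj_on (insert j) (Pow (J - {j}))"
    proof (rule inj_onI)
      fix A B assume "A \<in> Pow (J - {j})" "B \<in> Pow (J - {j})" "insert j A = insert j B"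
      then show "A = B" using insert_ident[of j A B] by blast
    qed
    then show ?thesis by (simp add: sum.reindex)
  qed
  finally show ?thesis by (simp add: sum.distrib)
qed

text \<open>Assouad's lemma, with the vertices of the hypercube written as subsets of \<open>J\<close>.\<close>

lemma assouad:
  fixes w :: "'a set \<Rightarrow> 'b \<Rightarrow> real"
  assumes "finite J" "finite \<Omega>"
    and nonneg: "\<And>T y. 0 \<le> w T y"
    and overlap: "\<And>T j. T \<subseteq> J \<Longrightarrow> j \<in> J \<Longrightarrow> j \<notin> T \<Longrightarrow> a \<le> (\<Sum>y\<in>\<Omega>. min (w T y) (w (insert j T) y))"
  shows "\<exists>T\<subseteq>J. a * card J / 2 \<le> (\<Sum>y\<in>\<Omega>. w T y * hamming J (S y) T)"
proof (rule ccontr)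
  assume "\<not> ?thesis"
  then have less: "(\<Sum>y\<in>\<Omega>. w T y * hamming J (S y) T) < a * card J / 2" if "T \<in> Pow J" for T
    using that by (meson PowD not_le)
  define h where "h j T = (\<Sum>y\<in>\<Omega>. w T y * of_bool ((j \<in> S y) \<noteq> (j \<in> T)))" for j T
  have ham: "real (hamming J A T) = (\<Sum>j\<in>J. of_bool ((j \<in> A) \<noteq> (j \<in> T)))" for A T
    using assms(1) by (simp add: hamming_def sum_of_bool_eq Int_def)
  \<comment> \<open>The Hamming risk is summed over all vertices and split by direction; if every
    vertex were below the bound, this total would be too small.\<close>
  have "a * card J / 2 * card (Pow J) = (\<Sum>j\<in>J. a * card (Pow J) / 2)" by simp
  also have "\<dots> \<le> (\<Sum>j\<in>J. \<Sum>T\<in>Pow J. h j T)"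
  proof (intro sum_mono)
    fix j assume j: "j \<in> J"
    have "a \<le> h j T + h j (insert j T)" if T: "T \<in> Pow (J - {j})" for T
    proof -
      have "a \<le> (\<Sum>y\<in>\<Omega>. min (w T y) (w (insert j T) y))" using T j by (intro overlap) auto
      \<comment> \<open>Whatever \<open>S y\<close> decides about \<open>j\<close>, it errs at
        exactly one of \<open>T\<close> and \<open>insert j T\<close>, so each summand on the right
        is one of the two weights.\<close>
      also have "\<dots> \<le> (\<Sum>y\<in>\<Omega>. w T y * of_bool ((j \<in> S y) \<noteq> (j \<in> T)) +
          w (insert j T) y * of_bool ((j \<in> S y) \<noteq> (j \<in> insert j T)))"
        using T by (intro sum_mono) (auto simp: nonneg)
      finally show ?thesis by (simp add: h_def sum.distrib)
    qed
    then have "(\<Sum>T\<in>Pow (J - {j}). a) \<le> (\<Sum>T\<in>Pow J. h j T)"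
      unfolding sum_Pow_split[OF assms(1) j] by (intro sum_mono)
    moreover have "card (Pow J) = 2 * card (Pow (J - {j}))"
      using assms(1) j by (simp add: card_Pow card_Diff_singleton flip: power_Suc)
        (metis Suc_pred card_gt_0_iff empty_iff)
    ultimately show "a * card (Pow J) / 2 \<le> (\<Sum>T\<in>Pow J. h j T)" by (simp add: mult.commute)
  qed
  also have "\<dots> = (\<Sum>T\<in>Pow J. \<Sum>y\<in>\<Omega>. w T y * hamming J (S y) T)"
    unfolding h_def ham sum_distrib_left
    by (subst sum.swap, intro sum.cong refl, rule sum.swap)
  also have "\<dots> < (\<Sum>T\<in>Pow J. a * card J / 2)"
    using less assms(1) by (intro sum_strict_mono) auto
  finally show False by (simp add: mult.commute)
qed

text \<open>The hypothesis nearest to the estimate is at most twice as far from the truth as the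
  estimate is, so the loss dominates \<open>\<Delta> / 4\<close> times a Hamming distance, to which
  \<open>assouad\<close> applies. The constant is \<open>64 = 4 * 8 * 2\<close>, from projection,
  overlap and averaging.\<close>

lemma risk_lower_bound:
  fixes \<rho> :: "'a set \<Rightarrow> nat \<Rightarrow> real" and \<Delta> :: real
  assumes "finite J" "a > 0" "\<Delta> \<ge> 0"
    and range: "\<And>T i. T \<subseteq> J \<Longrightarrow> i \<in> {1..n} \<Longrightarrow> \<rho> T i \<in> {a..1 - a}"
    and sep: "\<And>S T. S \<subseteq> J \<Longrightarrow> T \<subseteq> J \<Longrightarrow> \<Delta> * hamming J S T \<le> (norm_n n (\<lambda>i. \<rho> S i - \<rho> T i))\<^sup>2"
    and close: "\<And>T j. T \<subseteq> J \<Longrightarrow> j \<in> J \<Longrightarrow> j \<notin> T \<Longrightarrow>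
      real n * (norm_n n (\<lambda>i. \<rho> T i - \<rho> (insert j T) i))\<^sup>2 \<le> 2 * a"
  shows "\<exists>T\<subseteq>J. \<Delta> * card J / 64 \<le> risk n est (\<rho> T)"
proof -
  define S where "S Y = arg_min_on (\<lambda>T. (norm_n n (\<lambda>i. \<rho> T i - est Y i))\<^sup>2) (Pow J)" for Y
  have fin: "finite (Pow J)" "Pow J \<noteq> {}" using assms(1) by auto
  have S: "S Y \<subseteq> J" for Y
    using arg_min_if_finite(1)[OF fin] by (auto simp: S_def)
  have S_le: "(norm_n n (\<lambda>i. \<rho> (S Y) i - est Y i))\<^sup>2 \<le> (norm_n n (\<lambda>i. \<rho> T i - est Y i))\<^sup>2"
    if "T \<subseteq> J" for Y T
    unfolding S_def using that by (intro arg_min_least[OF fin]) auto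
  have loss: "\<Delta> / 4 * hamming J (S Y) T \<le> (norm_n n (\<lambda>i. est Y i - \<rho> T i))\<^sup>2" if T: "T \<subseteq> J" for Y T
  proof -
    have "\<Delta> * hamming J (S Y) T \<le> (norm_n n (\<lambda>i. \<rho> (S Y) i - \<rho> T i))\<^sup>2" by (rule sep[OF S T])
    also have "\<dots> \<le> 2 * (norm_n n (\<lambda>i. \<rho> (S Y) i - est Y i))\<^sup>2 + 2 * (norm_n n (\<lambda>i. est Y i - \<rho> T i))\<^sup>2"
      by (rule norm_n_sq_diff_le)
    also have "(norm_n n (\<lambda>i. \<rho> (S Y) i - est Y i))\<^sup>2 \<le> (norm_n n (\<lambda>i. est Y i - \<rho> T i))\<^sup>2"
      using S_le[OF T, of Y] by (simp add: norm_n_sq_eq power2_commute)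
    finally show ?thesis by simp
  qed
  have "\<exists>T\<subseteq>J. 1 / 8 * card J / 2 \<le> (\<Sum>Y\<in>label_space n. pmf (label_model n (\<rho> T)) Y * hamming J (S Y) T)"
    using assms(1,2) finite_label_space range close by (intro assouad overlap_label_model) auto
  then obtain T where T: "T \<subseteq> J"
    "1 / 8 * card J / 2 \<le> (\<Sum>Y\<in>label_space n. pmf (label_model n (\<rho> T)) Y * hamming J (S Y) T)" by blast
  have "\<Delta> * card J / 64 = \<Delta> / 4 * (1 / 8 * card J / 2)" by simp
  also have "\<dots> \<le> \<Delta> / 4 * (\<Sum>Y\<in>label_space n. pmf (label_model n (\<rho> T)) Y * hamming J (S Y) T)"
    using T(2) assms(3) by (intro mult_left_mono) auto
  also have "\<dots> = (\<Sum>Y\<in>label_space n. pmf (label_model n (\<rho> T)) Y * (\<Delta> / 4 * hamming J (S Y) T))"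
    by (simp add: sum_distrib_left mult_ac)
  also have "\<dots> \<le> risk n est (\<rho> T)"
    unfolding risk_def expectation_label_model by (intro sum_mono mult_left_mono loss T(1)) auto
  finally show ?thesis using T(1) by blast
qed

section \<open>Least squares over a finite class\<close>

text \<open>For \<open>x = - y < 0\<close> the bound is reciprocal: \<open>1 - y + y\<^sup>2\<close>
  times \<open>1 + y + y\<^sup>2 / 2\<close> is at least \<open>1\<close>, and the second factor is
  at most \<open>exp y\<close>.\<close>

lemma exp_le_quadratic:
  fixes x :: real
  assumes "\<bar>x\<bar> \<le> 1"
  shows "exp x \<le> 1 + x + x\<^sup>2"
proof (cases "0 \<le> x")
  case True
  then show ?thesis using assms exp_bound[of x] by simp
next
  case False
  define y where "y = - x"
  have y: "y > 0" using False by (simp add: y_def)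
  have "(1 - y + y\<^sup>2) * (1 + y + y\<^sup>2 / 2) = 1 + (y ^ 2 + y ^ 3 + y ^ 4) / 2"
    by (simp add: eval_nat_numeral field_simps)
  then have "1 \<le> (1 - y + y\<^sup>2) * (1 + y + y\<^sup>2 / 2)"
    using y by simp
  also have "\<dots> \<le> (1 - y + y\<^sup>2) * exp y"
  proof (rule mult_left_mono)
    show "1 + y + y\<^sup>2 / 2 \<le> exp y" using y by (intro exp_lower_Taylor_quadratic) simp
    show "0 \<le> 1 - y + y\<^sup>2"
      using assms zero_le_power2[of y] unfolding y_def by linarith
  qed
  finally have "exp (- y) \<le> 1 - y + y\<^sup>2" by (simp add: exp_minus field_simps)
  then show ?thesis by (simp add: y_def)
qed

text \<open>The variable is centred, so the linear terms of \<open>exp_le_quadratic\<close> cancel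
  and only \<open>h\<^sup>2\<close> times the variance \<open>p * (1 - p)\<close> remains.\<close>

lemma bernoulli_exp_moment:
  fixes h p :: real
  assumes "\<bar>h\<bar> \<le> 1" "0 \<le> p" "p \<le> 1"
  shows "p * exp (h * (1 - p)) + (1 - p) * exp (- (h * p)) \<le> exp (h\<^sup>2)"
proof -
  have "\<bar>h * (1 - p)\<bar> \<le> 1" "\<bar>- (h * p)\<bar> \<le> 1"
    using assms by (auto simp: abs_mult intro!: mult_le_one)
  then have "p * exp (h * (1 - p)) + (1 - p) * exp (- (h * p)) \<le>
      p * (1 + h * (1 - p) + (h * (1 - p))\<^sup>2) + (1 - p) * (1 + - (h * p) + (- (h * p))\<^sup>2)"
    using assms by (intro add_mono mult_left_mono exp_le_quadratic) auto
  also have "\<dots> = 1 + h\<^sup>2 * (p * (1 - p))" by (simp add: power2_eq_square algebra_simps)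
  also have "\<dots> \<le> 1 + h\<^sup>2 * 1"
    using assms by (intro add_left_mono mult_left_mono mult_le_one) auto
  also have "\<dots> \<le> exp (h\<^sup>2)" by simp
  finally show ?thesis .
qed

lemma label_model_exp_moment:
  assumes "\<And>i. i \<in> {1..n} \<Longrightarrow> 0 \<le> \<rho> i \<and> \<rho> i \<le> 1 \<and> \<bar>h i\<bar> \<le> 1"
  shows "measure_pmf.expectation (label_model n \<rho>) (\<lambda>Y. exp (\<Sum>i=1..n. h i * (of_bool (Y i) - \<rho> i)))
    \<le> exp (\<Sum>i=1..n. (h i)\<^sup>2)"
proof -
  have "measure_pmf.expectation (label_model n \<rho>) (\<lambda>Y. exp (\<Sum>i=1..n. h i * (of_bool (Y i) - \<rho> i))) =
      measure_pmf.expectation (label_model n \<rho>) (\<lambda>Y. \<Prod>i=1..n. exp (h i * (of_bool (Y i) - \<rho> i)))"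
    by (simp add: exp_sum)
  also have "\<dots> = (\<Prod>i=1..n. measure_pmf.expectation (bernoulli_pmf (\<rho> i)) (\<lambda>b. exp (h i * (of_bool b - \<rho> i))))"
    unfolding label_model_def
    by (rule expectation_prod_Pi_pmf) (auto intro!: integrable_measure_pmf_finite)
  also have "\<dots> \<le> (\<Prod>i=1..n. exp ((h i)\<^sup>2))"
  proof (intro prod_mono conjI)
    fix i assume i: "i \<in> {1..n}"
    show "measure_pmf.expectation (bernoulli_pmf (\<rho> i)) (\<lambda>b. exp (h i * (of_bool b - \<rho> i))) \<le> exp ((h i)\<^sup>2)"
      using assms[OF i] bernoulli_exp_moment[of "h i" "\<rho> i"] by (simp add: mult.commute)
  qed simp
  finally show ?thesis by (simp add: exp_sum)
qed

definition least_squares :: "nat \<Rightarrow> 'a set \<Rightarrow> ('a \<Rightarrow> nat \<Rightarrow> real) \<Rightarrow> (nat \<Rightarrow> bool) \<Rightarrow> nat \<Rightarrow> real" where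
  "least_squares n M s Y = s (arg_min_on (\<lambda>m. (\<Sum>i=1..n. (of_bool (Y i) - s m i)\<^sup>2)) M)"

text \<open>
  The cross term of the basic inequality is controlled uniformly over the class by
  \<open>x \<le> ln N - 1 + exp x / N\<close> and a union bound for exponential moments; its deviation
  is absorbed into the loss.
\<close>

lemma least_squares_risk:
  fixes s :: "'a \<Rightarrow> nat \<Rightarrow> real"
  assumes "n > 0" "finite M" "m0 \<in> M"
    and s: "\<And>m i. m \<in> M \<Longrightarrow> i \<in> {1..n} \<Longrightarrow> s m i \<in> {0..1}"
    and \<rho>: "\<And>i. i \<in> {1..n} \<Longrightarrow> \<rho> i \<in> {0..1}"
  shows "risk n (least_squares n M s) \<rho> \<le> 3 * (norm_n n (\<lambda>i. s m0 i - \<rho> i))\<^sup>2 + 32 * ln (card M) / n"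
proof -
  define A where "A = (\<Sum>i=1..n. (s m0 i - \<rho> i)\<^sup>2)"
  define X where "X Y = (\<Sum>i=1..n. (least_squares n M s Y i - \<rho> i)\<^sup>2)" for Y
  define Z where "Z m Y = (\<Sum>i=1..n. (s m i - s m0 i) * (of_bool (Y i) - \<rho> i))" for m Y
  define d where "d m = (\<Sum>i=1..n. (s m i - s m0 i)\<^sup>2)" for m
  \<comment> \<open>\<open>V m\<close> is the exponential of the scaled cross term, normalised by
    the moment bound for \<open>h i = (s m i - s m0 i) / 8\<close>, whose exponent is
    \<open>d m / 64\<close>; hence its expectation is at most \<open>1\<close>.\<close>
  define V where "V m Y = exp (Z m Y / 8 - d m / 64)" for m Y
  define W where "W Y = (\<Sum>m\<in>M. V m Y) / card M" for Y
  have card: "card M > 0" using assms by (auto simp: card_gt_0_iff)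
  have pointwise: "X Y \<le> 3 * A + 32 * (ln (card M) - 1 + W Y)" for Y
  proof -
    let ?f = "\<lambda>m. (\<Sum>i=1..n. (of_bool (Y i) - s m i)\<^sup>2)"
    define m where "m = arg_min_on ?f M"
    have m: "m \<in> M" unfolding m_def using assms(2,3) by (intro arg_min_if_finite(1)) auto
    have "?f m \<le> ?f m0"
      unfolding m_def using assms(2,3) by (intro arg_min_least) auto
    moreover have "?f m - ?f m0 = (\<Sum>i=1..n. (s m i - \<rho> i)\<^sup>2) - A - 2 * Z m Y"
      unfolding A_def Z_def sum_distrib_left sum_subtractf[symmetric]
      by (intro sum.cong refl) (simp add: power2_eq_square algebra_simps)
    moreover have X_eq: "X Y = (\<Sum>i=1..n. (s m i - \<rho> i)\<^sup>2)"
      by (simp add: X_def least_squares_def m_def)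
    ultimately have basic: "X Y \<le> A + 2 * Z m Y" by simp
    have "d m \<le> 2 * X Y + 2 * A"
      unfolding d_def X_eq A_def sum_distrib_left sum.distrib[symmetric]
    proof (rule sum_mono)
      fix i
      show "(s m i - s m0 i)\<^sup>2 \<le> 2 * (s m i - \<rho> i)\<^sup>2 + 2 * (s m0 i - \<rho> i)\<^sup>2"
        using zero_le_power2[of "(s m i - \<rho> i) + (s m0 i - \<rho> i)"]
        by (simp add: power2_eq_square algebra_simps)
    qed
    moreover have "Z m Y / 8 - d m / 64 \<le> ln (card M) - 1 + W Y"
    proof -
      have "1 + (Z m Y / 8 - d m / 64 - ln (card M)) \<le> exp (Z m Y / 8 - d m / 64 - ln (card M))"
        by (rule exp_ge_add_one_self)
      also have "\<dots> = V m Y / card M" using card by (simp add: V_def exp_diff)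
      \<comment> \<open>The minimiser \<open>m\<close> depends on \<open>Y\<close>, so its single
        term is replaced by the sum over all of \<open>M\<close>, whose expectation is under
        control.\<close>
      also have "\<dots> \<le> W Y"
        unfolding W_def using assms(2) m
        by (intro divide_right_mono member_le_sum) (auto simp: V_def)
      finally show ?thesis by simp
    qed
    \<comment> \<open>Together, \<open>2 * Z m Y\<close> is at most \<open>(X Y + A) / 2\<close>
      plus \<open>16\<close> times the logarithmic term; moving \<open>X Y / 2\<close> to the left
      and doubling gives the factors \<open>3\<close> and \<open>32\<close>.\<close>
    ultimately show ?thesis using basic by (simp add: field_simps)
  qed
  have V_moment: "measure_pmf.expectation (label_model n \<rho>) (V m) \<le> 1" if m: "m \<in> M" for m
  proof -
    have "\<bar>(s m i - s m0 i) / 8\<bar> \<le> 1" if "i \<in> {1..n}" for i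
      using s[OF m that] s[OF assms(3) that] by auto
    then have "measure_pmf.expectation (label_model n \<rho>)
        (\<lambda>Y. exp (\<Sum>i=1..n. (s m i - s m0 i) / 8 * (of_bool (Y i) - \<rho> i)))
      \<le> exp (\<Sum>i=1..n. ((s m i - s m0 i) / 8)\<^sup>2)"
      using \<rho> by (intro label_model_exp_moment) auto
    also have "(\<Sum>i=1..n. ((s m i - s m0 i) / 8)\<^sup>2) = d m / 64"
      by (simp add: d_def power_divide sum_divide_distrib)
    also have "(\<lambda>Y. exp (\<Sum>i=1..n. (s m i - s m0 i) / 8 * (of_bool (Y i) - \<rho> i))) = (\<lambda>Y. exp (d m / 64) * V m Y)"
      by (auto simp: V_def Z_def sum_divide_distrib simp flip: exp_add)
    finally show ?thesis by simp
  qed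
  have W_moment: "measure_pmf.expectation (label_model n \<rho>) W \<le> 1"
  proof -
    have "measure_pmf.expectation (label_model n \<rho>) W =
        (\<Sum>m\<in>M. measure_pmf.expectation (label_model n \<rho>) (V m)) / card M"
      unfolding W_def by (simp add: Bochner_Integration.integral_sum integrable_label_model)
    also have "\<dots> \<le> (\<Sum>m\<in>M. 1) / card M"
      by (intro divide_right_mono sum_mono V_moment) auto
    finally show ?thesis using card by simp
  qed
  have "risk n (least_squares n M s) \<rho> = measure_pmf.expectation (label_model n \<rho>) X / n"
    by (simp add: risk_def X_def[abs_def] norm_n_sq_eq)
  also have "\<dots> \<le> measure_pmf.expectation (label_model n \<rho>) (\<lambda>Y. 3 * A + 32 * (ln (card M) - 1 + W Y)) / n"
    by (intro divide_right_mono integral_mono integrable_label_model pointwise) auto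
  also have "\<dots> = (3 * A + 32 * (ln (card M) - 1 + measure_pmf.expectation (label_model n \<rho>) W)) / n"
    by (simp add: integrable_label_model)
  also have "\<dots> \<le> (3 * A + 32 * ln (card M)) / n"
    using W_moment by (intro divide_right_mono) auto
  finally show ?thesis by (simp add: A_def norm_n_sq_eq add_divide_distrib)
qed

section \<open>Lattice points in an ellipsoid\<close>

text \<open>For \<open>m \<noteq> 0\<close> and \<open>t = b * \<bar>m\<bar>\<close>, the summand
  \<open>exp (- t\<^sup>2)\<close> is at most \<open>1 / (1 + t\<^sup>2)\<close>, hence at most
  \<open>2 / (1 + t)\<^sup>2\<close>, hence at most \<open>2 / ((1 + t - b) * (1 + t))\<close>,
  which telescopes. The bound is uniform in \<open>B\<close>.\<close>

lemma sum_exp_neg_square_le: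
  fixes b :: real
  assumes "0 < b" "b \<le> 1"
  shows "(\<Sum>m\<in>{- int B..int B}. exp (- (b * m)\<^sup>2)) \<le> 5 / b"
proof -
  have "(\<Sum>m\<in>{- int B..int B}. exp (- (b * m)\<^sup>2)) \<le> 1 + 4 / b * (1 - 1 / (1 + b * B))"
  proof (induction B)
    case (Suc B)
    define M where "M = real B + 1"
    have M: "M \<ge> 1" "real B = M - 1" by (auto simp: M_def)
    have pos: "0 < b * M" "0 \<le> b * (M - 1)" using assms M by auto
    have "{- int (Suc B)..int (Suc B)} = insert (- int (Suc B)) (insert (int (Suc B)) {- int B..int B})"
      by auto
    then have "(\<Sum>m\<in>{- int (Suc B)..int (Suc B)}. exp (- (b * m)\<^sup>2)) =
        2 * exp (- (b * M)\<^sup>2) + (\<Sum>m\<in>{- int B..int B}. exp (- (b * m)\<^sup>2))"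
      by (simp add: M_def power2_eq_square algebra_simps)
    also have "exp (- (b * M)\<^sup>2) \<le> 1 / (1 + (b * M)\<^sup>2)"
      unfolding exp_minus inverse_eq_divide by (intro frac_le add_pos_nonneg) auto
    also have "1 / (1 + (b * M)\<^sup>2) \<le> 2 / (1 + b * M)\<^sup>2"
    proof -
      have "(1 + b * M)\<^sup>2 \<le> 2 * (1 + (b * M)\<^sup>2)"
        using zero_le_power2[of "1 - b * M"] by (simp add: power2_eq_square algebra_simps)
      moreover have "0 < (1 + b * M)\<^sup>2" using pos by simp
      moreover have "0 < 1 + (b * M)\<^sup>2" by (simp add: add_pos_nonneg)
      ultimately show ?thesis by (simp only: divide_le_eq le_divide_eq) (simp add: field_simps)
    qed
    also have "\<dots> \<le> 2 / ((1 + b * (M - 1)) * (1 + b * M))"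
    proof -
      have "0 < 1 + b * M" "0 < 1 + b * (M - 1)" using pos by linarith+
      then show ?thesis
        unfolding power2_eq_square using assms
        by (intro divide_left_mono mult_right_mono mult_pos_pos) (simp_all add: mult_left_mono)
    qed
    also have "\<dots> = 2 / b * (1 / (1 + b * (M - 1)) - 1 / (1 + b * M))"
      using pos assms by (simp add: divide_simps) (simp add: algebra_simps)
    also have "(\<Sum>m\<in>{- int B..int B}. exp (- (b * m)\<^sup>2)) \<le> 1 + 4 / b * (1 - 1 / (1 + b * (M - 1)))"
      using Suc.IH M by simp
    finally show ?case using M by (simp add: algebra_simps diff_divide_distrib)
  qed simp
  \<comment> \<open>The central term \<open>1\<close> is absorbed into \<open>1 / b\<close> because
    \<open>b \<le> 1\<close>.\<close>
  also have "\<dots> \<le> 1 / b + 4 / b * 1"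
    using assms by (intro add_mono mult_left_mono) (auto simp: field_simps)
  finally show ?thesis by simp
qed

text \<open>The box makes the set finite and is the product set over which Gaussian sums factorise;
  the cardinality bounds below are uniform in \<open>B\<close>.\<close>

definition lattice_ellipsoid :: "nat \<Rightarrow> (nat \<Rightarrow> real) \<Rightarrow> nat \<Rightarrow> real \<Rightarrow> (nat \<Rightarrow> int) set" where
  "lattice_ellipsoid N b B T = {m \<in> PiE {..<N} (\<lambda>_. {- int B..int B}). (\<Sum>j<N. (b j * m j)\<^sup>2) \<le> T}"

lemma finite_lattice_ellipsoid: "finite (lattice_ellipsoid N b B T)"
  unfolding lattice_ellipsoid_def by (rule finite_subset[OF _ finite_PiE[of "{..<N}" "\<lambda>_. {- int B..int B}"]]) auto

text \<open>Every point of the ellipsoid has Gaussian weight at least \<open>exp (- T)\<close>, so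
  the count is at most \<open>exp T\<close> times the total weight of the box, a product of
  one-dimensional sums.\<close>

lemma card_lattice_ellipsoid_le:
  assumes "\<And>j. j < N \<Longrightarrow> 0 < b j \<and> b j \<le> 1"
  shows "card (lattice_ellipsoid N b B T) \<le> exp T * (\<Prod>j<N. 5 / b j)"
proof -
  let ?P = "PiE {..<N} (\<lambda>_. {- int B..int B})"
  have "real (card (lattice_ellipsoid N b B T)) = (\<Sum>m\<in>lattice_ellipsoid N b B T. 1)" by simp
  also have "\<dots> \<le> (\<Sum>m\<in>lattice_ellipsoid N b B T. exp T * exp (- (\<Sum>j<N. (b j * m j)\<^sup>2)))"
    by (intro sum_mono) (simp add: lattice_ellipsoid_def flip: exp_add)
  also have "\<dots> \<le> (\<Sum>m\<in>?P. exp T * exp (- (\<Sum>j<N. (b j * m j)\<^sup>2)))"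
    by (intro sum_mono2 finite_PiE) (auto simp: lattice_ellipsoid_def)
  also have "\<dots> = exp T * (\<Sum>m\<in>?P. \<Prod>j<N. exp (- (b j * m j)\<^sup>2))"
    by (simp add: sum_distrib_left exp_sum flip: sum_negf)
  also have "(\<Sum>m\<in>?P. \<Prod>j<N. exp (- (b j * m j)\<^sup>2)) = (\<Prod>j<N. \<Sum>m\<in>{- int B..int B}. exp (- (b j * m)\<^sup>2))"
    by (subst prod_sum_PiE) auto
  also have "\<dots> \<le> (\<Prod>j<N. 5 / b j)"
    using assms by (intro prod_mono conjI sum_exp_neg_square_le sum_nonneg) auto
  finally show ?thesis by simp
qed

text \<open>\<open>N ^ N / fact N\<close> is a single term of the exponential series at
  \<open>N\<close>.\<close>

lemma power_self_le_exp_fact: "real N ^ N \<le> exp (real N) * fact N"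
proof -
  have "real N ^ N / fact N \<le> (\<Sum>k. real N ^ k /\<^sub>R fact k)"
    using sum_le_suminf[OF summable_exp_generic[of "real N"], of "{N}"]
    by (simp add: divide_inverse mult.commute)
  then show ?thesis by (simp add: exp_def field_simps)
qed

text \<open>The product of the reciprocal weights is \<open>N ^ N / fact N\<close> to the power
  \<open>\<alpha>\<close>, at most \<open>exp (\<alpha> * N)\<close>. As each coordinate is counted
  at its own scale, the entropy is linear in \<open>N\<close> without a factor
  \<open>ln N\<close>.\<close>

lemma ln_card_lattice_ellipsoid_le:
  assumes "\<alpha> > 0" "T \<ge> 0"
  shows "ln (card (lattice_ellipsoid N (\<lambda>j. (real (Suc j) / real N) powr \<alpha>) B T)) \<le> T + (ln 5 + \<alpha>) * N"
proof -
  let ?b = "\<lambda>j. (real (Suc j) / real N) powr \<alpha>"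
  let ?E = "lattice_ellipsoid N ?b B T"
  have "restrict (\<lambda>_. 0) {..<N} \<in> ?E"
    using assms(2) by (auto simp: lattice_ellipsoid_def)
  then have card: "card ?E > 0"
    using finite_lattice_ellipsoid card_gt_0_iff by blast
  have b_bounds: "0 < ?b j \<and> ?b j \<le> 1" if "j < N" for j
    using that assms by (auto intro!: powr_le1)
  have "real (card ?E) \<le> exp T * (\<Prod>j<N. 5 / ?b j)"
    by (rule card_lattice_ellipsoid_le) (rule b_bounds)
  also have "(\<Prod>j<N. 5 / ?b j) = 5 ^ N * (\<Prod>j<N. (real N / real (Suc j)) powr \<alpha>)"
  proof -
    have "5 / ?b j = 5 * (real N / real (Suc j)) powr \<alpha>" if "j < N" for j
      using that by (simp add: powr_divide)
    then have "(\<Prod>j<N. 5 / ?b j) = (\<Prod>j<N. 5 * (real N / real (Suc j)) powr \<alpha>)" by simp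
    then show ?thesis by (simp add: prod.distrib)
  qed
  also have "(\<Prod>j<N. (real N / real (Suc j)) powr \<alpha>) = (real N ^ N / fact N) powr \<alpha>"
  proof -
    have "(\<Prod>j<N. (real N / real (Suc j)) powr \<alpha>) = (\<Prod>j<N. real N / real (Suc j)) powr \<alpha>"
      by (rule prod_powr_distrib[symmetric])
    moreover have "(\<Prod>j<N. real (Suc j)) = fact N"
      by (simp add: fact_prod_Suc atLeast0LessThan)
    ultimately show ?thesis by (simp add: prod_dividef)
  qed
  also have "\<dots> \<le> exp (real N) powr \<alpha>"
    using assms(1) power_self_le_exp_fact[of N] by (intro powr_mono2) (auto simp: field_simps)
  finally have "real (card ?E) \<le> exp T * (5 ^ N * exp (real N) powr \<alpha>)" by simp
  also have "\<dots> = exp (T + (ln 5 + \<alpha>) * N)"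
  proof -
    have "5 ^ N = exp (real N * ln 5)" by (simp add: exp_of_nat_mult)
    then show ?thesis by (simp add: exp_powr_real algebra_simps flip: exp_add)
  qed
  finally have "ln (real (card ?E)) \<le> ln (exp (T + (ln 5 + \<alpha>) * N))"
    using card by (subst ln_le_cancel_iff) auto
  then show ?thesis by simp
qed

section \<open>Risk bounds for fixed sample size\<close>

text \<open>Rounding towards zero: it never increases the modulus, so rounded coefficients cannot
  leave the ellipsoid.\<close>

lemma truncate_int:
  fixes x :: real
  obtains m :: int where "\<bar>real_of_int m\<bar> \<le> \<bar>x\<bar>" "\<bar>x - m\<bar> \<le> 1"
proof (cases "x \<ge> 0")
  case True
  then have "0 \<le> real_of_int \<lfloor>x\<rfloor>" by simp
  moreover have "real_of_int \<lfloor>x\<rfloor> \<le> x" "x < real_of_int \<lfloor>x\<rfloor> + 1" by linarith+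
  ultimately show ?thesis using True by (intro that[of "\<lfloor>x\<rfloor>"]) linarith+
next
  case False
  then have "real_of_int \<lceil>x\<rceil> \<le> 0" by simp
  moreover have "x \<le> real_of_int \<lceil>x\<rceil>" "real_of_int \<lceil>x\<rceil> < x + 1" by linarith+
  ultimately show ?thesis using False by (intro that[of "\<lceil>x\<rceil>"]) linarith+
qed

lemma (in orthonormal_system) sobolev_ballD:
  assumes "f \<in> sobolev_ball r n lam psi \<beta> Q"
  shows "(\<Sum>j<n. (1 + (real n powr (2 / r) * lam j) powr \<beta>) * (inner_n n f (psi j))\<^sup>2) \<le> Q\<^sup>2"
  using assms by (simp add: sobolev_ball_def inner_sobolev parseval sum.distrib distrib_right)

text \<open>Least squares over lattice functions. \<open>low\<close> keeps the rounded coefficients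
  of every \<open>f\<close> in the ball inside the lattice ellipsoid, \<open>high\<close> bounds the
  truncated tail, both in terms of \<open>\<tau>\<close>; the last summand comes from the entropy
  divided by \<open>n\<close>.\<close>

lemma (in orthonormal_system) minimax_risk_le:
  fixes \<Psi> :: "real \<Rightarrow> real"
  assumes N: "0 < N" "N \<le> n"
    and pos: "\<alpha> > 0" "c > 0" "Q > 0"
    and range: "\<And>x. \<Psi> x \<in> {0<..<1}"
    and lip: "\<And>x y. \<bar>\<Psi> x - \<Psi> y\<bar> \<le> L * \<bar>x - y\<bar>"
    and low: "\<And>j. j < N \<Longrightarrow> c * real (Suc j) powr (2 * \<alpha>) \<le> 1 + (real n powr (2 / r) * lam j) powr \<beta>"
    and high: "\<And>j. N \<le> j \<Longrightarrow> j < n \<Longrightarrow> c * real N powr (2 * \<alpha>) \<le> 1 + (real n powr (2 / r) * lam j) powr \<beta>"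
  defines "\<tau> \<equiv> Q\<^sup>2 / (c * real N powr (2 * \<alpha>))"
  shows "minimax_risk n (link_class n \<Psi> (sobolev_ball r n lam psi \<beta> Q)) \<le>
    ereal (3 * L\<^sup>2 * (real N / n + \<tau>) + 32 * (\<tau> + (ln 5 + \<alpha>) * (real N / n)))"
proof -
  define w where "w j = 1 + (real n powr (2 / r) * lam j) powr \<beta>" for j
  \<comment> \<open>The integers \<open>m j\<close> approximate \<open>sqrt n\<close> times a
    coefficient, so squares scale by \<open>n\<close>: hence the level \<open>\<tau> * n\<close>.
    The box comes from the bound \<open>Q\<close> on each single coefficient.\<close>
  define M where "M = lattice_ellipsoid N (\<lambda>j. (real (Suc j) / real N) powr \<alpha>) (nat \<lceil>Q * sqrt n\<rceil>) (\<tau> * n)"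
  define g where "g m i = (\<Sum>j<N. real_of_int (m j) / sqrt n * psi j i)" for m :: "nat \<Rightarrow> int" and i
  have n: "0 < n" using N by simp
  have w: "1 \<le> w j" for j by (simp add: w_def)
  have w_nonneg: "0 \<le> w j * y\<^sup>2" for j y by (simp add: w_def)
  have cN: "0 < c * real N powr (2 * \<alpha>)" using pos N by simp
  have \<tau>: "\<tau> \<ge> 0" using pos by (simp add: \<tau>_def)
  have "risk n (least_squares n M (\<lambda>m i. \<Psi> (g m i))) \<rho> \<le>
      3 * L\<^sup>2 * (real N / n + \<tau>) + 32 * (\<tau> + (ln 5 + \<alpha>) * (real N / n))"
    if \<rho>: "\<rho> \<in> link_class n \<Psi> (sobolev_ball r n lam psi \<beta> Q)" for \<rho>
  proof -
    obtain f where f: "f \<in> sobolev_ball r n lam psi \<beta> Q" "\<And>i. i \<in> {1..n} \<Longrightarrow> \<rho> i = \<Psi> (f i)"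
      using \<rho> by (auto simp: link_class_def)
    define a where "a j = inner_n n f (psi j)" for j
    have ball: "(\<Sum>j<n. w j * (a j)\<^sup>2) \<le> Q\<^sup>2"
      using sobolev_ballD[OF f(1)] by (simp add: w_def a_def)
    have "\<forall>j. \<exists>m::int. \<bar>real_of_int m\<bar> \<le> \<bar>a j * sqrt n\<bar> \<and> \<bar>a j * sqrt n - m\<bar> \<le> 1"
      using truncate_int by metis
    then obtain k :: "nat \<Rightarrow> int" where k: "\<And>j. \<bar>real_of_int (k j)\<bar> \<le> \<bar>a j * sqrt n\<bar>"
      "\<And>j. \<bar>a j * sqrt n - k j\<bar> \<le> 1" by metis
    have k_sq: "(real_of_int (k j))\<^sup>2 \<le> n * (a j)\<^sup>2" for j
      using power_mono[OF k(1)[of j], of 2] by (simp add: power_mult_distrib mult.commute)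
    define m0 where "m0 = restrict k {..<N}"
    have "m0 \<in> M"
      unfolding M_def lattice_ellipsoid_def
    proof (intro CollectI conjI)
      have "k j \<in> {- int (nat \<lceil>Q * sqrt n\<rceil>)..int (nat \<lceil>Q * sqrt n\<rceil>)}" if "j < N" for j
      proof -
        have "(a j)\<^sup>2 \<le> w j * (a j)\<^sup>2" using w[of j] by (simp add: mult_le_cancel_right1)
        also have "\<dots> \<le> (\<Sum>j<n. w j * (a j)\<^sup>2)"
          using that N w_nonneg by (intro member_le_sum) auto
        also note ball
        finally have "\<bar>a j\<bar> \<le> Q" using pos by (simp add: abs_le_square_iff[symmetric])
        then have "\<bar>a j * sqrt n\<bar> \<le> Q * sqrt n" by (simp add: abs_mult mult_right_mono)
        then have "\<bar>real_of_int (k j)\<bar> \<le> Q * sqrt n" using k(1)[of j] by linarith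
        then have "real_of_int \<bar>k j\<bar> \<le> of_int \<lceil>Q * sqrt n\<rceil>" by linarith
        then have "\<bar>k j\<bar> \<le> \<lceil>Q * sqrt n\<rceil>" by linarith
        moreover have "int (nat \<lceil>Q * sqrt n\<rceil>) = \<lceil>Q * sqrt n\<rceil>" using calculation by linarith
        ultimately show ?thesis by simp linarith
      qed
      then show "m0 \<in> {..<N} \<rightarrow>\<^sub>E {- int (nat \<lceil>Q * sqrt n\<rceil>)..int (nat \<lceil>Q * sqrt n\<rceil>)}"
        by (auto simp: m0_def)
      have "(\<Sum>j<N. ((real (Suc j) / real N) powr \<alpha> * m0 j)\<^sup>2) \<le> (\<Sum>j<N. n / (c * real N powr (2 * \<alpha>)) * (w j * (a j)\<^sup>2))"
      proof (intro sum_mono)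
        fix j assume j: "j \<in> {..<N}"
        have "((real (Suc j) / real N) powr \<alpha> * m0 j)\<^sup>2 = real (Suc j) powr (2 * \<alpha>) / real N powr (2 * \<alpha>) * (real_of_int (k j))\<^sup>2"
          using j by (simp add: m0_def power_mult_distrib powr_divide power_divide powr_power mult.commute)
        also have "\<dots> \<le> (w j / c) / real N powr (2 * \<alpha>) * (n * (a j)\<^sup>2)"
          using low[of j] j pos k_sq[of j] w[of j] unfolding w_def[symmetric]
          by (intro mult_mono divide_right_mono) (auto simp: field_simps)
        finally show "((real (Suc j) / real N) powr \<alpha> * m0 j)\<^sup>2 \<le> n / (c * real N powr (2 * \<alpha>)) * (w j * (a j)\<^sup>2)"
          by (simp add: mult_ac)
      qed
      also have "\<dots> \<le> n / (c * real N powr (2 * \<alpha>)) * (\<Sum>j<n. w j * (a j)\<^sup>2)"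
        unfolding sum_distrib_left[symmetric] using N cN w_nonneg
        by (intro mult_left_mono sum_mono2) auto
      also have "\<dots> \<le> n / (c * real N powr (2 * \<alpha>)) * Q\<^sup>2"
        using cN by (intro mult_left_mono ball) auto
      finally show "(\<Sum>j<N. ((real (Suc j) / real N) powr \<alpha> * m0 j)\<^sup>2) \<le> \<tau> * n"
        by (simp add: \<tau>_def mult_ac)
    qed
    have "(norm_n n (\<lambda>i. g m0 i - f i))\<^sup>2 \<le> real N / n + \<tau>"
    proof -
      \<comment> \<open>The coefficient errors: at most \<open>1 / sqrt n\<close> from rounding
        below \<open>N\<close>, and the whole coefficient of \<open>f\<close>, up to sign, from
        \<open>N\<close> on.\<close>
      define e where "e j = (if j < N then k j / sqrt n else 0) - a j" for j
      have "g m0 i - f i = (\<Sum>j<n. e j * psi j i)" if "i \<in> {1..n}" for i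
      proof -
        have "g m0 i = (\<Sum>j<N. (if j < N then k j / sqrt n else 0) * psi j i)"
          by (simp add: g_def m0_def)
        also have "\<dots> = (\<Sum>j<n. (if j < N then k j / sqrt n else 0) * psi j i)"
          using N by (intro sum.mono_neutral_left) auto
        finally show ?thesis using expansion[OF that, of f]
          by (simp add: e_def a_def left_diff_distrib sum_subtractf)
      qed
      then have "(norm_n n (\<lambda>i. g m0 i - f i))\<^sup>2 = (norm_n n (\<lambda>i. \<Sum>j<n. e j * psi j i))\<^sup>2"
        unfolding norm_n_sq by (intro inner_n_cong) auto
      also have "\<dots> = (\<Sum>j<n. (e j)\<^sup>2)" by (rule norm_lincomb) simp
      also have "\<dots> \<le> (\<Sum>j<n. (if j < N then 1 / n else 0) + w j * (a j)\<^sup>2 / (c * real N powr (2 * \<alpha>)))"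
      proof (rule sum_mono)
        fix j assume j: "j \<in> {..<n}"
        have nn: "0 \<le> w j * (a j)\<^sup>2 / (c * real N powr (2 * \<alpha>))" using w_nonneg cN by simp
        show "(e j)\<^sup>2 \<le> (if j < N then 1 / n else 0) + w j * (a j)\<^sup>2 / (c * real N powr (2 * \<alpha>))"
        proof (cases "j < N")
          case True
          have "e j = - (a j * sqrt n - k j) / sqrt n" using True n by (simp add: e_def field_simps)
          then have "(e j)\<^sup>2 = \<bar>a j * sqrt n - k j\<bar>\<^sup>2 / n" by (simp add: power_divide power2_commute)
          also have "\<dots> \<le> 1\<^sup>2 / n" using k(2)[of j] by (intro divide_right_mono power_mono) auto
          finally show ?thesis using True nn by simp
        next
          case False
          have "(a j)\<^sup>2 * (c * real N powr (2 * \<alpha>)) \<le> (a j)\<^sup>2 * w j"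
            using high[of j] False j unfolding w_def[symmetric] by (intro mult_left_mono) auto
          then have "(a j)\<^sup>2 \<le> w j * (a j)\<^sup>2 / (c * real N powr (2 * \<alpha>))"
            using cN by (subst pos_le_divide_eq) (auto simp: mult_ac)
          then show ?thesis using False by (simp add: e_def)
        qed
      qed
      also have "\<dots> = real N / n + (\<Sum>j<n. w j * (a j)\<^sup>2) / (c * real N powr (2 * \<alpha>))"
      proof -
        have "(\<Sum>j<n. if j < N then 1 / real n else 0) = (\<Sum>j<N. 1 / real n)"
          using N by (intro sum.mono_neutral_cong_right) auto
        then show ?thesis by (simp add: sum.distrib sum_divide_distrib)
      qed
      also have "\<dots> \<le> real N / n + \<tau>"
        unfolding \<tau>_def using ball cN by (intro add_left_mono divide_right_mono) auto
      finally show ?thesis .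
    qed
    moreover have "(norm_n n (\<lambda>i. \<Psi> (g m0 i) - \<rho> i))\<^sup>2 \<le> (norm_n n (\<lambda>i. L * (g m0 i - f i)))\<^sup>2"
    proof (rule norm_n_sq_mono)
      fix i assume "i \<in> {1..n}"
      then have "\<bar>\<Psi> (g m0 i) - \<rho> i\<bar> \<le> \<bar>L * (g m0 i - f i)\<bar>"
        using lip[of "g m0 i" "f i"] f(2) by (simp add: abs_mult order_trans[OF _ mult_right_mono[OF abs_ge_self]])
      then show "(\<Psi> (g m0 i) - \<rho> i)\<^sup>2 \<le> (L * (g m0 i - f i))\<^sup>2" by (simp add: abs_le_square_iff)
    qed
    moreover have "(norm_n n (\<lambda>i. L * (g m0 i - f i)))\<^sup>2 = L\<^sup>2 * (norm_n n (\<lambda>i. g m0 i - f i))\<^sup>2"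
      by (rule norm_n_sq_scale)
    ultimately have approx: "(norm_n n (\<lambda>i. \<Psi> (g m0 i) - \<rho> i))\<^sup>2 \<le> L\<^sup>2 * (real N / n + \<tau>)"
      using mult_left_mono[of "(norm_n n (\<lambda>i. g m0 i - f i))\<^sup>2" "real N / n + \<tau>" "L\<^sup>2"] by simp
    have "ln (card M) / n \<le> (\<tau> * n + (ln 5 + \<alpha>) * N) / n"
      unfolding M_def using pos \<tau> by (intro divide_right_mono ln_card_lattice_ellipsoid_le) auto
    also have "\<dots> = \<tau> + (ln 5 + \<alpha>) * (real N / n)" using n by (simp add: add_divide_distrib)
    finally have entropy: "ln (card M) / n \<le> \<tau> + (ln 5 + \<alpha>) * (real N / n)" .
    have "risk n (least_squares n M (\<lambda>m i. \<Psi> (g m i))) \<rho> \<le>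
        3 * (norm_n n (\<lambda>i. \<Psi> (g m0 i) - \<rho> i))\<^sup>2 + 32 * ln (card M) / n"
    proof (rule least_squares_risk[OF n _ \<open>m0 \<in> M\<close>])
      show "finite M" by (simp add: M_def finite_lattice_ellipsoid)
      show "\<Psi> (g m i) \<in> {0..1}" for m i using range[of "g m i"] by simp
      show "\<rho> i \<in> {0..1}" if "i \<in> {1..n}" for i using range[of "f i"] f(2)[OF that] by simp
    qed
    also have "\<dots> \<le> 3 * (L\<^sup>2 * (real N / n + \<tau>)) + 32 * (\<tau> + (ln 5 + \<alpha>) * (real N / n))"
      using approx entropy by simp
    finally show ?thesis by simp
  qed
  then show ?thesis
    unfolding minimax_risk_def by (intro INF_lower2[OF UNIV_I] SUP_least) simp
qed

text \<open>Applies \<open>risk_lower_bound\<close> to a hypercube of functions around the constant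
  \<open>x0\<close>. \<open>radius\<close> keeps their values where the lower Lipschitz bound holds,
  \<open>energy\<close> keeps them in the ball, and \<open>noise\<close> makes neighbouring vertices
  hard to distinguish.\<close>

lemma (in orthonormal_system) minimax_risk_ge:
  fixes \<Psi> :: "real \<Rightarrow> real"
  assumes n: "0 < n" and J: "J \<subseteq> {..<n}"
    and pos: "a > 0" "\<delta> \<ge> 0" "c \<ge> 0"
    and range: "\<And>x. \<Psi> x \<in> {0<..<1}"
    and local_range: "\<And>x. \<bar>x - x0\<bar> \<le> \<eta> \<Longrightarrow> \<Psi> x \<in> {a..1 - a}"
    and lip: "\<And>x y. \<bar>\<Psi> x - \<Psi> y\<bar> \<le> L * \<bar>x - y\<bar>"
    and lower_lip: "\<And>x y. \<bar>x - x0\<bar> \<le> \<eta> \<Longrightarrow> \<bar>y - x0\<bar> \<le> \<eta> \<Longrightarrow> c * \<bar>x - y\<bar> \<le> \<bar>\<Psi> x - \<Psi> y\<bar>"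
    and psi_bound: "\<And>j i. j < n \<Longrightarrow> i \<in> {1..n} \<Longrightarrow> \<bar>psi j i\<bar> \<le> C"
    and const: "\<And>j. j < n \<Longrightarrow> lam j = 0 \<or> inner_n n (\<lambda>_. x0) (psi j) = 0"
    and x0: "x0\<^sup>2 \<le> Q\<^sup>2 / 4"
    and radius: "\<delta> * C * card J \<le> \<eta>"
    and energy: "\<delta>\<^sup>2 * (\<Sum>j\<in>J. 2 + (real n powr (2 / r) * lam j) powr \<beta>) \<le> Q\<^sup>2 / 2"
    and noise: "real n * (L\<^sup>2 * \<delta>\<^sup>2) \<le> 2 * a"
  shows "ereal (c\<^sup>2 * \<delta>\<^sup>2 * card J / 64) \<le> minimax_risk n (link_class n \<Psi> (sobolev_ball r n lam psi \<beta> Q))"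
proof -
  define f where "f T i = x0 + (\<Sum>j\<in>T. \<delta> * psi j i)" for T i
  define w where "w j = (real n powr (2 / r) * lam j) powr \<beta>" for j
  have finJ: "finite J" using J finite_subset by blast
  have f_near: "\<bar>f T i - x0\<bar> \<le> \<eta>" if T: "T \<subseteq> J" and i: "i \<in> {1..n}" for T i
  proof -
    have "\<bar>f T i - x0\<bar> \<le> (\<Sum>j\<in>T. \<bar>\<delta> * psi j i\<bar>)" by (simp add: f_def)
    also have "\<dots> \<le> (\<Sum>j\<in>J. \<bar>\<delta> * psi j i\<bar>)" using T finJ by (intro sum_mono2) auto
    also have "\<dots> \<le> (\<Sum>j\<in>J. \<delta> * C)"
      using J pos psi_bound i by (intro sum_mono) (auto simp: abs_mult intro!: mult_left_mono)
    finally show ?thesis using radius by (simp add: mult_ac)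
  qed
  have diff: "(norm_n n (\<lambda>i. f S i - f T i))\<^sup>2 = \<delta>\<^sup>2 * hamming J S T" if "S \<subseteq> J" "T \<subseteq> J" for S T
  proof -
    have "f S i - f T i = (\<Sum>j\<in>J. (\<delta> * (of_bool (j \<in> S) - of_bool (j \<in> T))) * psi j i)" for i
    proof -
      have "(\<Sum>j\<in>R. \<delta> * psi j i) = (\<Sum>j\<in>J. \<delta> * of_bool (j \<in> R) * psi j i)" if "R \<subseteq> J" for R
        using finJ that by (intro sum.mono_neutral_cong_left) auto
      then show ?thesis using that
        by (simp add: f_def right_diff_distrib left_diff_distrib sum_subtractf)
    qed
    then have "(norm_n n (\<lambda>i. f S i - f T i))\<^sup>2 = (\<Sum>j\<in>J. (\<delta> * (of_bool (j \<in> S) - of_bool (j \<in> T)))\<^sup>2)"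
      by (simp only: norm_lincomb[OF J])
    also have "\<dots> = (\<Sum>j\<in>J. \<delta>\<^sup>2 * of_bool ((j \<in> S) \<noteq> (j \<in> T)))"
      by (intro sum.cong) (auto simp: power_mult_distrib)
    also have "\<dots> = \<delta>\<^sup>2 * hamming J S T"
      using finJ by (simp add: hamming_def sum_of_bool_eq Int_def flip: sum_distrib_left)
    finally show ?thesis .
  qed
  have ball: "restrict (f T) {1..n} \<in> sobolev_ball r n lam psi \<beta> Q" if T: "T \<subseteq> J" for T
  proof -
    have Tn: "T \<subseteq> {..<n}" using T J by blast
    let ?g = "\<lambda>i. \<Sum>j\<in>T. \<delta> * psi j i"
    \<comment> \<open>Members of the ball are extensional, hence the restriction; inner products
      only see \<open>{1..n}\<close>.\<close>
    have inner_r: "inner_n n (restrict (f T) {1..n}) h = inner_n n (f T) h" for h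
      by (intro inner_n_cong) auto
    \<comment> \<open>Splitting off the centre doubles both squared norms, which accounts for
      \<open>x0\<^sup>2 \<le> Q\<^sup>2 / 4\<close> and for the \<open>2\<close> in
      \<open>energy\<close>.\<close>
    have "(norm_n n (f T))\<^sup>2 \<le> 2 * (norm_n n (\<lambda>_. x0))\<^sup>2 + 2 * (norm_n n ?g)\<^sup>2"
      using norm_n_sq_diff_le[of n "f T" "\<lambda>_. 0" ?g] by (simp add: f_def[abs_def])
    also have "(norm_n n (\<lambda>_. x0))\<^sup>2 = x0\<^sup>2" using n by (simp add: norm_n_sq_eq)
    also have "(norm_n n ?g)\<^sup>2 = (\<Sum>j\<in>T. \<delta>\<^sup>2)" by (rule norm_lincomb[OF Tn])
    finally have norm_f: "(norm_n n (f T))\<^sup>2 \<le> Q\<^sup>2 / 2 + (\<Sum>j\<in>T. 2 * \<delta>\<^sup>2)" using x0 by simp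
    \<comment> \<open>The constant centre has no Sobolev energy: where
      \<open>lam j \<noteq> 0\<close> its coefficient vanishes, and where \<open>lam j = 0\<close>
      the weight is \<open>0 powr \<beta> = 0\<close>.\<close>
    have "w j * (inner_n n (f T) (psi j))\<^sup>2 = (if j \<in> T then w j * \<delta>\<^sup>2 else 0)" if j: "j < n" for j
    proof (cases "lam j = 0")
      case False
      have "inner_n n (f T) (psi j) = inner_n n (\<lambda>_. x0) (psi j) + inner_n n ?g (psi j)"
        by (simp add: f_def inner_n_def distrib_right sum.distrib add_divide_distrib)
      also have "\<dots> = (if j \<in> T then \<delta> else 0)"
        using const[OF j] False inner_lincomb[OF Tn j, of "\<lambda>_. \<delta>"] by simp
      finally show ?thesis by simp
    qed (simp add: w_def)
    then have "(\<Sum>j<n. w j * (inner_n n (f T) (psi j))\<^sup>2) = (\<Sum>j<n. if j \<in> T then w j * \<delta>\<^sup>2 else 0)"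
      by (intro sum.cong) auto
    also have "\<dots> = (\<Sum>j\<in>T. w j * \<delta>\<^sup>2)" using Tn by (intro sum.mono_neutral_cong_right) auto
    finally have "(norm_n n (f T))\<^sup>2 + (\<Sum>j<n. w j * (inner_n n (f T) (psi j))\<^sup>2)
        \<le> Q\<^sup>2 / 2 + (\<Sum>j\<in>T. \<delta>\<^sup>2 * (2 + w j))"
      using norm_f by (simp add: distrib_left sum.distrib mult.commute)
    also have "\<dots> \<le> Q\<^sup>2 / 2 + (\<Sum>j\<in>J. \<delta>\<^sup>2 * (2 + w j))"
      using T finJ by (intro add_left_mono sum_mono2) (auto simp: w_def)
    also have "\<dots> \<le> Q\<^sup>2" using energy by (simp add: w_def sum_distrib_left)
    finally have "(norm_n n (f T))\<^sup>2 + (\<Sum>j<n. w j * (inner_n n (f T) (psi j))\<^sup>2) \<le> Q\<^sup>2" .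
    moreover have "(norm_n n (restrict (f T) {1..n}))\<^sup>2 = (norm_n n (f T))\<^sup>2"
      unfolding norm_n_sq by (intro inner_n_cong) auto
    ultimately have "(norm_n n (restrict (f T) {1..n}))\<^sup>2 +
        (\<Sum>j<n. w j * (inner_n n (restrict (f T) {1..n}) (psi j))\<^sup>2) \<le> Q\<^sup>2"
      by (simp only: inner_r)
    then show ?thesis
      unfolding sobolev_ball_def by (intro CollectI conjI restrict_PiE_iff[THEN iffD2])
        (simp_all only: inner_sobolev w_def, auto)
  qed
  have in_class: "restrict (\<lambda>i. \<Psi> (f T i)) {1..n} \<in> link_class n \<Psi> (sobolev_ball r n lam psi \<beta> Q)"
    if T: "T \<subseteq> J" for T
    unfolding link_class_def using ball[OF T] range by (auto intro!: bexI[of _ "restrict (f T) {1..n}"])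
  have "ereal (c\<^sup>2 * \<delta>\<^sup>2 * card J / 64) \<le>
      (SUP \<rho>\<in>link_class n \<Psi> (sobolev_ball r n lam psi \<beta> Q). ereal (risk n est \<rho>))" for est
  proof -
    have "\<exists>T\<subseteq>J. (c\<^sup>2 * \<delta>\<^sup>2) * card J / 64 \<le> risk n est (restrict (\<lambda>i. \<Psi> (f T i)) {1..n})"
    proof (rule risk_lower_bound[where \<rho> = "\<lambda>T. restrict (\<lambda>i. \<Psi> (f T i)) {1..n}" and \<Delta> = "c\<^sup>2 * \<delta>\<^sup>2", OF finJ pos(1)])
      show "restrict (\<lambda>i. \<Psi> (f T i)) {1..n} i \<in> {a..1 - a}" if "T \<subseteq> J" "i \<in> {1..n}" for T i
        using local_range[OF f_near[OF that]] that by simp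
      show "c\<^sup>2 * \<delta>\<^sup>2 * hamming J S T \<le>
          (norm_n n (\<lambda>i. restrict (\<lambda>i. \<Psi> (f S i)) {1..n} i - restrict (\<lambda>i. \<Psi> (f T i)) {1..n} i))\<^sup>2"
        if "S \<subseteq> J" "T \<subseteq> J" for S T
      proof -
        have "c\<^sup>2 * \<delta>\<^sup>2 * hamming J S T = (norm_n n (\<lambda>i. c * (f S i - f T i)))\<^sup>2"
          using diff[OF that] by (simp add: norm_n_sq_scale)
        also have "\<dots> \<le> (norm_n n (\<lambda>i. restrict (\<lambda>i. \<Psi> (f S i)) {1..n} i - restrict (\<lambda>i. \<Psi> (f T i)) {1..n} i))\<^sup>2"
        proof (rule norm_n_sq_mono)
          fix i assume i: "i \<in> {1..n}"
          have "\<bar>c * (f S i - f T i)\<bar> \<le> \<bar>\<Psi> (f S i) - \<Psi> (f T i)\<bar>"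
            using lower_lip[OF f_near f_near, OF that(1) i that(2) i] pos by (simp add: abs_mult)
          then show "(c * (f S i - f T i))\<^sup>2 \<le>
              (restrict (\<lambda>i. \<Psi> (f S i)) {1..n} i - restrict (\<lambda>i. \<Psi> (f T i)) {1..n} i)\<^sup>2"
            using i by (simp add: abs_le_square_iff)
        qed
        finally show ?thesis .
      qed
      show "real n * (norm_n n (\<lambda>i. restrict (\<lambda>i. \<Psi> (f T i)) {1..n} i -
          restrict (\<lambda>i. \<Psi> (f (insert j T) i)) {1..n} i))\<^sup>2 \<le> 2 * a"
        if "T \<subseteq> J" "j \<in> J" "j \<notin> T" for T j
      proof -
        have "(norm_n n (\<lambda>i. restrict (\<lambda>i. \<Psi> (f T i)) {1..n} i -
            restrict (\<lambda>i. \<Psi> (f (insert j T) i)) {1..n} i))\<^sup>2 \<le> (norm_n n (\<lambda>i. L * (f T i - f (insert j T) i)))\<^sup>2"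
        proof (rule norm_n_sq_mono)
          fix i assume i: "i \<in> {1..n}"
          have "\<bar>\<Psi> (f T i) - \<Psi> (f (insert j T) i)\<bar> \<le> \<bar>L * (f T i - f (insert j T) i)\<bar>"
            using lip[of "f T i" "f (insert j T) i"]
            by (rule order_trans) (simp add: abs_mult mult_right_mono)
          then show "(restrict (\<lambda>i. \<Psi> (f T i)) {1..n} i - restrict (\<lambda>i. \<Psi> (f (insert j T) i)) {1..n} i)\<^sup>2
              \<le> (L * (f T i - f (insert j T) i))\<^sup>2"
            using i by (simp add: abs_le_square_iff)
        qed
        also have "\<dots> = L\<^sup>2 * (\<delta>\<^sup>2 * hamming J T (insert j T))"
          using diff[of T "insert j T"] that
          by (simp add: norm_n_sq_scale subset_insertI2)
        also have "hamming J T (insert j T) = 1"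
        proof -
          have "{k \<in> J. (k \<in> T) \<noteq> (k \<in> insert j T)} = {j}" using that by auto
          then show ?thesis by (simp add: hamming_def)
        qed
        finally have "(norm_n n (\<lambda>i. restrict (\<lambda>i. \<Psi> (f T i)) {1..n} i -
            restrict (\<lambda>i. \<Psi> (f (insert j T) i)) {1..n} i))\<^sup>2 \<le> L\<^sup>2 * \<delta>\<^sup>2" by simp
        then show ?thesis by (rule order_trans[OF mult_left_mono noise]) simp
      qed
    qed simp
    then show ?thesis using in_class by (auto intro!: SUP_upper2)
  qed
  then show ?thesis unfolding minimax_risk_def by (intro INF_greatest)
qed

section \<open>Rates\<close>

text \<open>The factor \<open>n powr (2 / r)\<close> cancels \<open>n\<close> from the geometry
  bounds. Nonnegativity of \<open>lam n i\<close> is recorded because monotonicity of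
  \<open>powr\<close> relies on it.\<close>

lemma geometry_weights:
  assumes "geometry_assumption r lam" "r \<ge> 1" "\<beta> > 0"
  obtains i0 :: nat and \<kappa> c c' :: real where "\<kappa> > 0" "c > 0" "c' > 0"
    "\<forall>\<^sub>F n in sequentially. \<forall>i. i0 \<le> i \<and> real i \<le> \<kappa> * real n \<and> i < n \<longrightarrow>
      0 \<le> lam n i \<and>
      c * real i powr (2 * (\<beta> / r)) \<le> (real n powr (2 / r) * lam n i) powr \<beta> \<and>
      (real n powr (2 / r) * lam n i) powr \<beta> \<le> c' * real i powr (2 * (\<beta> / r))"
proof -
  obtain i0 :: nat and \<kappa> C1 C2 :: real where const: "\<kappa> > 0" "C1 > 0" "C2 > 0"
    and ev: "\<forall>\<^sub>F n in sequentially. \<forall>i. i0 \<le> i \<and> real i \<le> \<kappa> * real n \<and> i < n \<longrightarrow>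
      C1 * (real i / real n) powr (2 / r) \<le> lam n i \<and> lam n i \<le> C2 * (real i / real n) powr (2 / r)"
    using assms(1) unfolding geometry_assumption_def by blast
  have scale: "(real n powr (2 / r) * (C * (real i / real n) powr (2 / r))) powr \<beta> =
      C powr \<beta> * real i powr (2 * (\<beta> / r))" if "C > 0" "i < n" for C i n
  proof -
    have "real n powr (2 / r) * (C * (real i / real n) powr (2 / r)) = C * real i powr (2 / r)"
      using that by (simp add: mult.left_commute flip: powr_mult)
    then have "(real n powr (2 / r) * (C * (real i / real n) powr (2 / r))) powr \<beta> =
        (C * real i powr (2 / r)) powr \<beta>" by (rule arg_cong)
    also have "\<dots> = C powr \<beta> * real i powr (2 * (\<beta> / r))" by (simp add: powr_mult powr_powr)
    finally show ?thesis .
  qed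
  show ?thesis
  proof (rule that[OF const(1)])
    show "C1 powr \<beta> > 0" "C2 powr \<beta> > 0" using const by auto
    show "\<forall>\<^sub>F n in sequentially. \<forall>i. i0 \<le> i \<and> real i \<le> \<kappa> * real n \<and> i < n \<longrightarrow>
      0 \<le> lam n i \<and>
      C1 powr \<beta> * real i powr (2 * (\<beta> / r)) \<le> (real n powr (2 / r) * lam n i) powr \<beta> \<and>
      (real n powr (2 / r) * lam n i) powr \<beta> \<le> C2 powr \<beta> * real i powr (2 * (\<beta> / r))"
      using ev
    proof (rule eventually_mono, intro allI impI)
      fix n i
      assume *: "\<forall>i. i0 \<le> i \<and> real i \<le> \<kappa> * real n \<and> i < n \<longrightarrow>
        C1 * (real i / real n) powr (2 / r) \<le> lam n i \<and> lam n i \<le> C2 * (real i / real n) powr (2 / r)"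
      assume i: "i0 \<le> i \<and> real i \<le> \<kappa> * real n \<and> i < n"
      have le: "C1 * (real i / real n) powr (2 / r) \<le> lam n i" "lam n i \<le> C2 * (real i / real n) powr (2 / r)"
        using * i by auto
      moreover have "0 \<le> C1 * (real i / real n) powr (2 / r)" using const by simp
      ultimately have nn: "0 \<le> lam n i" by linarith
      have "C1 powr \<beta> * real i powr (2 * (\<beta> / r)) \<le> (real n powr (2 / r) * lam n i) powr \<beta>"
        unfolding scale[OF const(2), of i n, symmetric, OF conjunct2[OF conjunct2[OF i]]]
        using le const assms(3) by (intro powr_mono2 mult_left_mono) auto
      moreover have "(real n powr (2 / r) * lam n i) powr \<beta> \<le> C2 powr \<beta> * real i powr (2 * (\<beta> / r))"
        unfolding scale[OF const(3), of i n, symmetric, OF conjunct2[OF conjunct2[OF i]]]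
        using le nn assms(3) by (intro powr_mono2 mult_left_mono) auto
      ultimately show "0 \<le> lam n i \<and>
        C1 powr \<beta> * real i powr (2 * (\<beta> / r)) \<le> (real n powr (2 / r) * lam n i) powr \<beta> \<and>
        (real n powr (2 / r) * lam n i) powr \<beta> \<le> C2 powr \<beta> * real i powr (2 * (\<beta> / r))"
        using nn by blast
    qed
  qed
qed

text \<open>
  The bandwidth \<open>N\<close> balances \<open>N / n\<close> against \<open>N powr (- 2 * \<alpha>)\<close>: with
  \<open>x = n powr (1 / (2 * \<alpha> + 1))\<close> both are of the order \<open>x / n = x powr (- 2 * \<alpha>)\<close>.
\<close>

lemma bandwidth:
  fixes \<alpha> \<kappa> :: real
  assumes "\<alpha> \<ge> 1 / 2" "\<kappa> > 0"
  shows "\<forall>\<^sub>F n in sequentially. \<exists>N. i0 \<le> N \<and> 0 < N \<and> 2 * N \<le> n \<and> 2 * real N \<le> \<kappa> * real n \<and>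
    real N \<le> 2 * sqrt n \<and>
    real n powr (- (2 * \<alpha>) / (2 * \<alpha> + 1)) \<le> real N / n \<and>
    real N / n \<le> 2 * real n powr (- (2 * \<alpha>) / (2 * \<alpha> + 1)) \<and>
    real N powr (- (2 * \<alpha>)) \<le> real n powr (- (2 * \<alpha>) / (2 * \<alpha> + 1)) \<and>
    real N / n * real N powr (2 * \<alpha>) \<le> 2 powr (2 * \<alpha> + 1)"
proof -
  define p where "p = 1 / (2 * \<alpha> + 1)"
  \<comment> \<open>Here \<open>\<alpha> \<ge> 1 / 2\<close> enters: \<open>p \<le> 1 / 2\<close>
    makes the bandwidth at most of order \<open>sqrt n\<close>.\<close>
  have p: "0 < p" "p \<le> 1 / 2" using assms(1) by (auto simp: p_def field_simps)
  have "filterlim (\<lambda>n. real n powr p) at_top sequentially"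
    using p by real_asymp
  then have ev1: "\<forall>\<^sub>F n in sequentially. real i0 + 1 \<le> real n powr p"
    by (simp add: filterlim_at_top)
  have "((\<lambda>n. real n powr (p - 1)) \<longlongrightarrow> 0) sequentially"
    using p by real_asymp
  \<comment> \<open>This gives \<open>4 * x \<le> n\<close> and
    \<open>4 * x \<le> \<kappa> * n\<close>, enough for \<open>2 * N\<close> because
    \<open>N \<le> 2 * x\<close>.\<close>
  then have ev2: "\<forall>\<^sub>F n in sequentially. real n powr (p - 1) < min 1 \<kappa> / 4"
    using assms(2) by (intro order_tendstoD) auto
  show ?thesis
    using ev1 ev2 eventually_gt_at_top[of 0]
  proof eventually_elim
    case (elim n)
    define x where "x = real n powr p"
    define N where "N = nat \<lceil>x\<rceil>"
    have x: "x \<ge> real i0 + 1" using elim by (simp add: x_def)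
    have N: "x \<le> real N" "real N \<le> x + 1" using x unfolding N_def by linarith+
    then have N2: "real N \<le> 2 * x" using x by simp
    have n: "real n > 0" using elim by simp
    have xn: "x / n = real n powr (p - 1)" using n by (simp add: x_def powr_diff)
    have exponent: "- (2 * \<alpha>) / (2 * \<alpha> + 1) = p - 1" using assms(1) by (simp add: p_def field_simps)
    have small: "4 * x \<le> min 1 \<kappa> * n"
    proof -
      have "x < min 1 \<kappa> / 4 * n" using elim(2) unfolding xn[symmetric] pos_divide_less_eq[OF n] .
      then show ?thesis by simp
    qed
    have pow: "x powr (- (2 * \<alpha>)) = real n powr (p - 1)"
    proof -
      have "p * (- (2 * \<alpha>)) = p - 1" using assms(1) by (simp add: p_def field_simps)
      then show ?thesis by (simp add: x_def powr_powr)
    qed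
    have pow': "x / n * x powr (2 * \<alpha>) = 1"
      unfolding xn pow[symmetric] using x by (simp flip: powr_add)
    show ?case
      unfolding exponent
    proof (intro exI[of _ N] conjI)
      show "i0 \<le> N" "0 < N" using N x by linarith+
      have "min 1 \<kappa> * n \<le> 1 * real n" "min 1 \<kappa> * n \<le> \<kappa> * n" by (intro mult_right_mono; simp)+
      then have "2 * real N \<le> real n" "2 * real N \<le> \<kappa> * real n" using small N2 by linarith+
      then show "2 * N \<le> n" "2 * real N \<le> \<kappa> * real n" by linarith+
      have "x \<le> real n powr (1 / 2)" unfolding x_def using p elim by (intro powr_mono) auto
      then show "real N \<le> 2 * sqrt n" using N2 by (simp add: powr_half_sqrt)
      show "real n powr (p - 1) \<le> real N / n" unfolding xn[symmetric] using N n by (intro divide_right_mono) auto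
      have "real N / n \<le> 2 * x / n" using N2 n by (intro divide_right_mono) auto
      then show "real N / n \<le> 2 * real n powr (p - 1)" unfolding xn[symmetric] by simp
      show "real N powr - (2 * \<alpha>) \<le> real n powr (p - 1)"
        unfolding pow[symmetric] using N x assms(1) by (intro powr_mono2') auto
      have "real N / n * real N powr (2 * \<alpha>) \<le> (2 * x) / n * (2 * x) powr (2 * \<alpha>)"
        using N2 x n assms(1) by (intro mult_mono divide_right_mono powr_mono2) auto
      also have "\<dots> = 2 * 2 powr (2 * \<alpha>) * (x / n * x powr (2 * \<alpha>))" by (simp add: powr_mult)
      also have "\<dots> = 2 powr (2 * \<alpha> + 1)" using pow' x by (simp add: powr_add)
      finally show "real N / n * real N powr (2 * \<alpha>) \<le> 2 powr (2 * \<alpha> + 1)" .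
    qed
  qed
qed

lemma same_orderI:
  fixes b :: "nat \<Rightarrow> real"
  assumes "K1 > 0"
    and "\<forall>\<^sub>F n in sequentially. 0 < b n \<and> ereal (K1 * b n) \<le> a n \<and> a n \<le> ereal (K2 * b n)"
  shows "a \<asymp> (\<lambda>n. ereal (b n))"
proof -
  have "\<forall>\<^sub>F n in sequentially. ereal K1 \<le> a n / ereal (b n)"
    using assms(2) by eventually_elim (auto simp: ereal_le_divide_pos mult.commute)
  then have "ereal K1 \<le> liminf (\<lambda>n. a n / ereal (b n))" by (rule Liminf_bounded)
  moreover have "\<forall>\<^sub>F n in sequentially. a n / ereal (b n) \<le> ereal K2"
    using assms(2) by eventually_elim (auto simp: ereal_divide_le_pos mult.commute)
  then have "limsup (\<lambda>n. a n / ereal (b n)) \<le> ereal K2" by (rule Limsup_bounded)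
  ultimately show ?thesis
    using assms(1) unfolding same_order_def
    by (auto intro: less_le_trans[of 0 "ereal K1"] le_less_trans[of _ "ereal K2"])
qed

theorem theorem3p2:
  fixes G :: "nat \<Rightarrow> nat pair_pre_digraph"
    and lam :: "nat \<Rightarrow> nat \<Rightarrow> real"
    and psi :: "nat \<Rightarrow> nat \<Rightarrow> nat \<Rightarrow> real"
    and \<Psi> \<Psi>' :: "real \<Rightarrow> real"
    and r \<beta> Q :: real
  assumes "\<And>n. n \<ge> 1 \<Longrightarrow> simple_connected_graph_on {1..n} (G n)"
    and "\<And>n. n \<ge> 1 \<Longrightarrow> laplacian_eigensystem n (G n) (lam n) (psi n)"
    and "r \<ge> 1"
    and "geometry_assumption r lam"
    and "\<exists>C>0. \<forall>n\<ge>1. \<forall>j<n. \<forall>i\<in>{1..n}. \<bar>psi n j i\<bar> \<le> C"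
    and "\<And>x. \<Psi> x \<in> {0<..<1}"
    and "\<And>x. (\<Psi> has_real_derivative \<Psi>' x) (at x)"
    and "bounded (range (\<lambda>x. \<Psi>' x / (\<Psi> x * (1 - \<Psi> x))))"
    and "\<And>x. \<Psi>' x > 0"
    and "\<beta> \<ge> r / 2"
    and "Q > 0"
  shows "(\<lambda>n. minimax_risk n (link_class n \<Psi> (sobolev_ball r n (lam n) (psi n) \<beta> Q)))
           \<asymp> (\<lambda>n. ereal (real n powr (- (2 * \<beta>) / (2 * \<beta> + r))))"
proof -
  note graph = assms(1) and eigen = assms(2) and r = assms(3) and geometry = assms(4)
    and bounded_psi = assms(5) and range = assms(6) and deriv = assms(7) and link = assms(8)
    and deriv_pos = assms(9) and \<beta> = assms(10) and Q = assms(11)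
  define \<alpha> where "\<alpha> = \<beta> / r"
  have \<alpha>: "\<alpha> \<ge> 1 / 2" using \<beta> r by (simp add: \<alpha>_def field_simps)
  have \<beta>_pos: "\<beta> > 0" using \<beta> r by linarith
  have rate: "- (2 * \<beta>) / (2 * \<beta> + r) = - (2 * \<alpha>) / (2 * \<alpha> + 1)"
  proof -
    have "\<beta> = \<alpha> * r" using r by (simp add: \<alpha>_def)
    then have "- (2 * \<beta>) = r * (- (2 * \<alpha>))" "2 * \<beta> + r = r * (2 * \<alpha> + 1)"
      by (simp_all add: algebra_simps)
    then show ?thesis using r by (simp only:) (rule mult_divide_mult_cancel_left, simp)
  qed
  define R where "R n = real n powr (- (2 * \<alpha>) / (2 * \<alpha> + 1))" for n :: nat
  define w where "w n j = (real n powr (2 / r) * lam n j) powr \<beta>" for n j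
  obtain L where L: "L > 0" "\<And>x y. \<bar>\<Psi> x - \<Psi> y\<bar> \<le> L * \<bar>x - y\<bar>"
    using link_lipschitz[OF range deriv link] by blast
  \<comment> \<open>The radius \<open>Q / 2\<close> for the centre leaves half of the budget
    \<open>Q\<^sup>2\<close> to the perturbations.\<close>
  obtain x0 \<eta> c0 where x0: "\<bar>x0\<bar> \<le> Q / 2" "\<eta> > 0" "c0 > 0"
    and lower_lip: "\<And>x y. \<bar>x - x0\<bar> \<le> \<eta> \<Longrightarrow> \<bar>y - x0\<bar> \<le> \<eta> \<Longrightarrow> c0 * \<bar>x - y\<bar> \<le> \<bar>\<Psi> x - \<Psi> y\<bar>"
    using pos_derivative_lower_lipschitz[OF deriv deriv_pos, of "Q / 2"] Q
    by (metis half_gt_zero)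
  define a where "a = min (\<Psi> (x0 - \<eta>)) (1 - \<Psi> (x0 + \<eta>))"
  have a: "a > 0" using range[of "x0 - \<eta>"] range[of "x0 + \<eta>"] by (simp add: a_def)
  have mono: "\<Psi> x \<le> \<Psi> y" if "x \<le> y" for x y
    using DERIV_nonneg_imp_nondecreasing[OF that, of \<Psi>] deriv deriv_pos by (meson less_imp_le)
  have local_range: "\<Psi> x \<in> {a..1 - a}" if "\<bar>x - x0\<bar> \<le> \<eta>" for x
    using mono[of "x0 - \<eta>" x] mono[of x "x0 + \<eta>"] that by (auto simp: a_def min_def abs_le_iff)
  obtain C where C: "C > 0" "\<And>n j i. n \<ge> 1 \<Longrightarrow> j < n \<Longrightarrow> i \<in> {1..n} \<Longrightarrow> \<bar>psi n j i\<bar> \<le> C"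
    using bounded_psi by blast
  obtain i0 :: nat and \<kappa> c c' :: real where const: "\<kappa> > 0" "c > 0" "c' > 0"
    and geo: "\<forall>\<^sub>F n in sequentially. \<forall>i. i0 \<le> i \<and> real i \<le> \<kappa> * real n \<and> i < n \<longrightarrow>
      0 \<le> lam n i \<and> c * real i powr (2 * \<alpha>) \<le> w n i \<and> w n i \<le> c' * real i powr (2 * \<alpha>)"
    using geometry_weights[OF geometry r \<beta>_pos, folded \<alpha>_def w_def] .
  \<comment> \<open>At least \<open>1\<close>, so that
    \<open>real i1 powr (- (2 * \<alpha>))\<close> is positive and \<open>Suc j \<le> 2 * j\<close>
    for \<open>j \<ge> i1\<close>.\<close>
  define i1 where "i1 = max 1 i0"
  \<comment> \<open>One constant for two regimes: below \<open>i1\<close> the identity part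
    \<open>1\<close> of the weight must suffice; from \<open>i1\<close> on,
    \<open>2 powr (- (2 * \<alpha>))\<close> pays for the shift from \<open>j\<close> to
    \<open>Suc j\<close>.\<close>
  define b where "b = min (c * 2 powr (- (2 * \<alpha>))) (real i1 powr (- (2 * \<alpha>)))"
  have b: "b > 0" using const by (simp add: b_def i1_def)
  define K2 where "K2 = 3 * L\<^sup>2 * (2 + Q\<^sup>2 / b) + 32 * (Q\<^sup>2 / b + (ln 5 + \<alpha>) * 2)"
  define D where "D = 4 + 2 powr (2 * \<alpha>) * c' * 2 powr (2 * \<alpha> + 1)"
  have D: "D > 0" using const by (simp add: D_def add_pos_pos)
  \<comment> \<open>The entries of the minimum serve, in order,
    \<open>\<epsilon>\<^sup>2 \<le> \<epsilon>\<close> and the radius, energy and noise conditions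
    of \<open>minimax_risk_ge\<close>; the first makes bounds linear in \<open>\<epsilon>\<close>
    sufficient.\<close>
  define \<epsilon> where "\<epsilon> = min 1 (min (\<eta> / (2 * C)) (min (Q\<^sup>2 / (2 * D)) (2 * a / L\<^sup>2)))"
  have \<epsilon>: "\<epsilon> > 0" "\<epsilon> \<le> 1" "\<epsilon> \<le> \<eta> / (2 * C)" "\<epsilon> \<le> Q\<^sup>2 / (2 * D)" "\<epsilon> \<le> 2 * a / L\<^sup>2"
    using x0 C D Q a L by (auto simp: \<epsilon>_def)
  have \<epsilon>_sq: "\<epsilon>\<^sup>2 \<le> \<epsilon>" using \<epsilon> by (simp add: power2_eq_square mult_left_le)
  define K1 where "K1 = c0\<^sup>2 * \<epsilon>\<^sup>2 / 64"
  show ?thesis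
    unfolding rate R_def[symmetric]
  proof (rule same_orderI)
    show "K1 > 0" using x0 \<epsilon> by (simp add: K1_def)
    show "\<forall>\<^sub>F n in sequentially. 0 < R n \<and>
        ereal (K1 * R n) \<le> minimax_risk n (link_class n \<Psi> (sobolev_ball r n (lam n) (psi n) \<beta> Q)) \<and>
        minimax_risk n (link_class n \<Psi> (sobolev_ball r n (lam n) (psi n) \<beta> Q)) \<le> ereal (K2 * R n)"
      using geo bandwidth[OF \<alpha> const(1), of i1] eventually_ge_at_top[of 1]
    proof eventually_elim
      case (elim n)
      obtain N where N: "i1 \<le> N" "0 < N" "2 * N \<le> n" "2 * real N \<le> \<kappa> * real n"
          "real N \<le> 2 * sqrt n" "R n \<le> real N / n" "real N / n \<le> 2 * R n"
          "real N powr (- (2 * \<alpha>)) \<le> R n" "real N / n * real N powr (2 * \<alpha>) \<le> 2 powr (2 * \<alpha> + 1)"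
        using elim(2) unfolding R_def by blast
      have n: "n \<ge> 1" "real n > 0" using elim by auto
      have R: "R n > 0" using n by (simp add: R_def)
      have geo_n: "0 \<le> lam n i" "c * real i powr (2 * \<alpha>) \<le> w n i" "w n i \<le> c' * real i powr (2 * \<alpha>)"
        if "i0 \<le> i" "i \<le> 2 * N" "i < n" for i
      proof -
        have "real i \<le> \<kappa> * real n" using that(2) N(4) by linarith
        then show "0 \<le> lam n i" "c * real i powr (2 * \<alpha>) \<le> w n i" "w n i \<le> c' * real i powr (2 * \<alpha>)"
          using elim(1) that by auto
      qed
      have sys: "laplacian_eigensystem n (G n) (lam n) (psi n)" using eigen n by simp
      interpret orthonormal_system n "psi n"
        using sys by unfold_locales (auto simp: laplacian_eigensystem_def)
      have lam_mono: "lam n j \<le> lam n k" if "j \<le> k" "k < n" for j k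
        using sys that by (simp add: laplacian_eigensystem_def)
      have b_le: "b * real (Suc j) powr (2 * \<alpha>) \<le> 1 + w n j" if "j < N" for j
      proof (cases "j < i1")
        case True
        have "b * real (Suc j) powr (2 * \<alpha>) \<le> real i1 powr (- (2 * \<alpha>)) * real i1 powr (2 * \<alpha>)"
          using True \<alpha> b by (intro mult_mono powr_mono2) (auto simp: b_def)
        also have "\<dots> = 1" by (simp add: i1_def flip: powr_add)
        also have "1 \<le> 1 + w n j" by (simp add: w_def)
        finally show ?thesis .
      next
        case False
        have "b * real (Suc j) powr (2 * \<alpha>) \<le> c * 2 powr (- (2 * \<alpha>)) * (2 * real j) powr (2 * \<alpha>)"
          using False \<alpha> b const by (intro mult_mono powr_mono2) (auto simp: b_def i1_def)
        also have "\<dots> = c * (2 powr (- (2 * \<alpha>)) * 2 powr (2 * \<alpha>)) * real j powr (2 * \<alpha>)" by (simp add: powr_mult)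
        also have "\<dots> = c * real j powr (2 * \<alpha>)" by (simp flip: powr_add)
        also have "\<dots> \<le> w n j" using False that N by (intro geo_n(2)) (auto simp: i1_def)
        also have "\<dots> \<le> 1 + w n j" by simp
        finally show ?thesis .
      qed
      \<comment> \<open>The geometry bounds reach only up to \<open>\<kappa> * n\<close>; the
        ordering of the eigenvalues carries the bound at \<open>N\<close> to all larger
        indices.\<close>
      have b_le': "b * real N powr (2 * \<alpha>) \<le> 1 + w n j" if "N \<le> j" "j < n" for j
      proof -
        have "b \<le> c * 2 powr (- (2 * \<alpha>))" by (simp add: b_def)
        also have "\<dots> \<le> c * 1" using const \<alpha> by (intro mult_left_mono) (auto simp: powr_minus intro!: inverse_le_1_iff[THEN iffD2] ge_one_powr_ge_zero)
        finally have "b * real N powr (2 * \<alpha>) \<le> c * real N powr (2 * \<alpha>)" by (simp add: mult_right_mono)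
        also have "\<dots> \<le> w n N" using geo_n(2)[of N] N that by (simp add: i1_def)
        also have "\<dots> \<le> w n j"
          unfolding w_def using lam_mono[OF that] geo_n(1)[of N] N that \<beta>_pos
          by (intro powr_mono2 mult_left_mono) (auto simp: i1_def)
        finally show ?thesis by simp
      qed
      have "minimax_risk n (link_class n \<Psi> (sobolev_ball r n (lam n) (psi n) \<beta> Q)) \<le>
          ereal (3 * L\<^sup>2 * (real N / n + Q\<^sup>2 / (b * real N powr (2 * \<alpha>))) +
            32 * (Q\<^sup>2 / (b * real N powr (2 * \<alpha>)) + (ln 5 + \<alpha>) * (real N / n)))"
        using N \<alpha> b Q range L b_le b_le' unfolding w_def by (intro minimax_risk_le) auto
      also have "\<dots> \<le> ereal (3 * L\<^sup>2 * (2 * R n + Q\<^sup>2 / b * R n) + 32 * (Q\<^sup>2 / b * R n + (ln 5 + \<alpha>) * (2 * R n)))"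
      proof -
        have "Q\<^sup>2 / (b * real N powr (2 * \<alpha>)) = Q\<^sup>2 / b * real N powr (- (2 * \<alpha>))"
          by (simp add: powr_minus divide_inverse)
        also have "\<dots> \<le> Q\<^sup>2 / b * R n" using N(8) b by (intro mult_left_mono) auto
        finally show ?thesis
          using N(7) \<alpha> by (simp only: ereal_less_eq(3)) (intro add_mono mult_left_mono, auto)
      qed
      also have "\<dots> = ereal (K2 * R n)" by (simp add: K2_def algebra_simps)
      finally have upper: "minimax_risk n (link_class n \<Psi> (sobolev_ball r n (lam n) (psi n) \<beta> Q)) \<le> ereal (K2 * R n)" .

      \<comment> \<open>All weights in this dyadic block are comparable to
        \<open>N powr (2 * \<alpha>)\<close>, and \<open>2 * N \<le> \<kappa> * n\<close> keeps the
        block in the range of the geometry bounds.\<close>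
      define J where "J = {N..<2 * N}"
      have card_J: "card J = N" by (simp add: J_def)
      define \<delta> where "\<delta> = \<epsilon> / sqrt n"
      have \<delta>_sq: "\<delta>\<^sup>2 = \<epsilon>\<^sup>2 / n" by (simp add: \<delta>_def power_divide)
      have "ereal (c0\<^sup>2 * \<delta>\<^sup>2 * card J / 64) \<le>
          minimax_risk n (link_class n \<Psi> (sobolev_ball r n (lam n) (psi n) \<beta> Q))"
      proof (rule minimax_risk_ge[where C = C and \<eta> = \<eta> and a = a and L = L and ?x0.0 = x0])
        show "J \<subseteq> {..<n}" using N by (auto simp: J_def)
        show "0 < n" "0 < a" "0 \<le> c0" using n a x0 by auto
        show "0 \<le> \<delta>" using \<epsilon> by (simp add: \<delta>_def)
        show "lam n j = 0 \<or> inner_n n (\<lambda>_. x0) (psi n j) = 0" if "j < n" for j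
          using eigenfunction_orthogonal_const[OF graph sys that] n by blast
        show "x0\<^sup>2 \<le> Q\<^sup>2 / 4"
          using x0(1) Q abs_le_square_iff[of x0 "Q / 2"] by (simp add: power_divide)
        \<comment> \<open>Bounded eigenfunctions give perturbations of supremum norm at most
          \<open>\<delta> * C * N\<close>; since \<open>N \<le> 2 * sqrt n\<close>, this does not
          grow with \<open>n\<close>.\<close>
        have "\<delta> * C * card J \<le> \<epsilon> / sqrt n * C * (2 * sqrt n)"
          unfolding card_J \<delta>_def using N(5) \<epsilon> C by (intro mult_left_mono) auto
        also have "\<dots> = 2 * C * \<epsilon>" using n by simp
        also have "\<dots> \<le> \<eta>" using \<epsilon>(3) C by (simp add: field_simps)
        finally show "\<delta> * C * card J \<le> \<eta>" .
        have "(\<Sum>j\<in>J. 2 + w n j) \<le> (\<Sum>j\<in>J. 2 + c' * (2 powr (2 * \<alpha>) * real N powr (2 * \<alpha>)))"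
        proof (intro sum_mono add_left_mono)
          fix j assume j: "j \<in> J"
          have "w n j \<le> c' * real j powr (2 * \<alpha>)" using geo_n(3)[of j] j N by (simp add: J_def i1_def)
          also have "\<dots> \<le> c' * (2 * real N) powr (2 * \<alpha>)"
            using j \<alpha> const by (intro mult_left_mono powr_mono2) (auto simp: J_def)
          finally show "w n j \<le> c' * (2 powr (2 * \<alpha>) * real N powr (2 * \<alpha>))" by (simp add: powr_mult)
        qed
        then have "\<delta>\<^sup>2 * (\<Sum>j\<in>J. 2 + w n j) \<le> \<delta>\<^sup>2 * (\<Sum>j\<in>J. 2 + c' * (2 powr (2 * \<alpha>) * real N powr (2 * \<alpha>)))"
          by (intro mult_left_mono) auto
        also have "\<dots> = \<epsilon>\<^sup>2 * (2 * (real N / n) + 2 powr (2 * \<alpha>) * c' * (real N / n * real N powr (2 * \<alpha>)))"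
          by (simp add: card_J \<delta>_sq algebra_simps add_divide_distrib)
        also have "\<dots> \<le> \<epsilon>\<^sup>2 * D"
        proof -
          have "real N / n \<le> 1" using N(3) n by simp
          then have "2 * (real N / n) \<le> 4" by simp
          moreover have "2 powr (2 * \<alpha>) * c' * (real N / n * real N powr (2 * \<alpha>)) \<le> 2 powr (2 * \<alpha>) * c' * 2 powr (2 * \<alpha> + 1)"
            using N(9) const by (intro mult_left_mono) auto
          ultimately show ?thesis unfolding D_def by (intro mult_left_mono[OF add_mono]) auto
        qed
        also have "\<dots> \<le> \<epsilon> * D" using \<epsilon>_sq D by (intro mult_right_mono) auto
        also have "\<dots> \<le> Q\<^sup>2 / 2" using \<epsilon>(4) D by (simp add: field_simps)
        finally show "\<delta>\<^sup>2 * (\<Sum>j\<in>J. 2 + (real n powr (2 / r) * lam n j) powr \<beta>) \<le> Q\<^sup>2 / 2"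
          by (simp add: w_def)
        have "real n * (L\<^sup>2 * \<delta>\<^sup>2) = L\<^sup>2 * \<epsilon>\<^sup>2" using n by (simp add: \<delta>_sq)
        also have "\<dots> \<le> L\<^sup>2 * \<epsilon>" using \<epsilon>_sq by (intro mult_left_mono) auto
        also have "\<dots> \<le> 2 * a" using \<epsilon>(5) L by (simp add: field_simps)
        finally show "real n * (L\<^sup>2 * \<delta>\<^sup>2) \<le> 2 * a" .
      qed (use range local_range L(2) lower_lip C(2) n in auto)
      moreover have "K1 * R n \<le> c0\<^sup>2 * \<delta>\<^sup>2 * card J / 64"
      proof -
        have "K1 * R n \<le> K1 * (real N / n)" using N(6) by (intro mult_left_mono) (auto simp: K1_def)
        then show ?thesis by (simp add: K1_def card_J \<delta>_sq)
      qed
      ultimately show ?case using R upper by (meson ereal_less_eq(3) order_trans)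
    qed
  qed
qed

end
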